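(* Every positive parenthesized braid $x$ (i.e., every $x\in B_\bullet^+$) admits two unique decompositions: $$x=z_1\cdot\partial z_2\cdot\ldots\cdot\partial^{p-1}z_p,$$ $$x=\beta_1\cdot\partial\beta_2\cdot\ldots\cdot\partial^{n-1}\beta_n\cdot h_1\cdot\partial h_2\cdot\ldots\cdot\partial^{n-1}h_n,$$ where $z_1,\dots,z_p$ are special parenthesized braids, $\beta_1,\dots,\beta_n$ are special braids, and $h_1,\dots,h_n$ are special Thompson elements.
   Context: $B_\bullet$ is the group (of parenthesized braids) presented by generators $\sigma_i,a_i$ ($i\ge1$) and the relations, for all $i\ge1$ and $j\ge i+2$: $\sigma_i\sigma_j=\sigma_j\sigma_i$, $\sigma_ia_j=a_j\sigma_i$, $a_ia_{j-1}=a_ja_i$, $a_i\sigma_{j-1}=\sigma_ja_i$, $\sigma_i\sigma_{i+1}\sigma_i=\sigma_{i+1}\sigma_i\sigma_{i+1}$, $\sigma_{i+1}\sigma_ia_{i+1}=a_i\sigma_i$, $\sigma_i\sigma_{i+1}a_i=a_{i+1}\sigma_i$. $B_\bullet^+$ is the submonoid generated by all $\sigma_i$'s and $a_i$'s. The map $\partial$ is the injective endomorphism of $B_\bullet$ with $\sigma_i\mapsto\sigma_{i+1}$, $a_i\mapsto a_{i+1}$ for every $i$. Put $x\lceil y\rceil=x\cdot\partial y\cdot\sigma_1\cdot(\partial x)^{-1}$ and $x\circ y=x\cdot\partial y\cdot a_1$ for $x,y\in B_\bullet$. A special braid (resp. special Thompson element, resp. special parenthesized braid) is an element of the closure of $\{1\}$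 in $B_\bullet$ under the bracket operation $x,y\mapsto x\lceil y\rceil$ (resp. under $\circ$, resp. under both the bracket and $\circ$). *)

theory Defs
  imports Main
begin

text \<open>
  The group \<open>B\<^sub>\<bullet>\<close> of parenthesized braids, given by generators and relations.
  All indices start from \<open>0\<close>: the generators usually written \<open>\<sigma>\<^sub>i, a\<^sub>i\<close> with \<open>i \<ge> 1\<close> are
  \<open>Sig (i - 1)\<close>, \<open>Alp (i - 1)\<close> here. The relations are invariant under a shift of the indices,
  so they keep their usual form.
\<close>

datatype gen = Sig nat | Alp nat

inductive bullet_rel :: "gen list \<Rightarrow> gen list \<Rightarrow> bool" where
  sig_sig: "j \<ge> i + 2 \<Longrightarrow> bullet_rel [Sig i, Sig j] [Sig j, Sig i]"
| sig_alp: "j \<ge> i + 2 \<Longrightarrow> bullet_rel [Sig i, Alp j] [Alp j, Sig i]"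
| alp_alp: "j \<ge> i + 2 \<Longrightarrow> bullet_rel [Alp i, Alp (j - 1)] [Alp j, Alp i]"
| alp_sig: "j \<ge> i + 2 \<Longrightarrow> bullet_rel [Alp i, Sig (j - 1)] [Sig j, Alp i]"
| braid: "bullet_rel [Sig i, Sig (i + 1), Sig i] [Sig (i + 1), Sig i, Sig (i + 1)]"
| sig_sig_alp: "bullet_rel [Sig (i + 1), Sig i, Alp (i + 1)] [Alp i, Sig i]"
| sig_sig_alp': "bullet_rel [Sig i, Sig (i + 1), Alp i] [Alp (i + 1), Sig i]"

text \<open>
  Group words: the letter \<open>(g, True)\<close> stands for \<open>g\<close>, and \<open>(g, False)\<close> for its inverse.
\<close>

type_synonym word = "(gen \<times> bool) list"

abbreviation pos_word :: "gen list \<Rightarrow> word" where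
  "pos_word r \<equiv> map (\<lambda>g. (g, True)) r"

inductive word_eq :: "word \<Rightarrow> word \<Rightarrow> bool" where
  refl: "word_eq u u"
| sym: "word_eq u v \<Longrightarrow> word_eq v u"
| trans: "word_eq u v \<Longrightarrow> word_eq v w \<Longrightarrow> word_eq u w"
| cancel: "word_eq (u @ (g, b) # (g, \<not> b) # v) (u @ v)"
| rel: "bullet_rel r s \<Longrightarrow> word_eq (u @ pos_word r @ v) (u @ pos_word s @ v)"

lemma equivp_word_eq: "equivp word_eq"
  by (rule equivpI) (auto simp: reflp_def symp_def transp_def intro: word_eq.intros)

quotient_type bullet = word / word_eq
  by (rule equivp_word_eq)

lemma word_eq_context: "word_eq u v \<Longrightarrow> word_eq (p @ u @ q) (p @ v @ q)"
proof (induction rule: word_eq.induct)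
  case (cancel u g b v)
  show ?case using word_eq.cancel[of "p @ u" g b "v @ q"] by simp
next
  case (rel r s u v)
  then show ?case using word_eq.rel[of r s "p @ u" "v @ q"] by simp
qed (auto intro: word_eq.intros)

lemma word_eq_append: "word_eq u u' \<Longrightarrow> word_eq v v' \<Longrightarrow> word_eq (u @ v) (u' @ v')"
  using word_eq_context[of u u' "[]" v] word_eq_context[of v v' u' "[]"]
  by (auto intro: word_eq.trans)

definition inv_word :: "word \<Rightarrow> word" where
  "inv_word w = rev (map (\<lambda>(g, b). (g, \<not> b)) w)"

lemma inv_word_append [simp]: "inv_word (u @ v) = inv_word v @ inv_word u"
  by (simp add: inv_word_def)

lemma inv_word_inv_word [simp]: "inv_word (inv_word w) = w"
  by (induction w) (auto simp: inv_word_def)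

lemma word_eq_left_inverse: "word_eq (inv_word w @ w) []"
proof (induction w)
  case Nil
  show ?case by (simp add: inv_word_def word_eq.refl)
next
  case (Cons x w)
  obtain g b where x: "x = (g, b)" by (cases x)
  have "word_eq (inv_word w @ (g, \<not> b) # (g, \<not> \<not> b) # w) (inv_word w @ w)"
    by (rule word_eq.cancel)
  moreover have "inv_word (x # w) @ x # w = inv_word w @ (g, \<not> b) # (g, \<not> \<not> b) # w"
    by (simp add: x inv_word_def)
  ultimately show ?case
    using Cons.IH by (metis word_eq.trans)
qed

lemma word_eq_right_inverse: "word_eq (w @ inv_word w) []"
  using word_eq_left_inverse[of "inv_word w"] by simp

lemma inv_word_cong: 
  assumes "word_eq u v"
  shows "word_eq (inv_word u) (inv_word v)"
proof -
  have "word_eq (inv_word u @ v @ inv_word v) (inv_word u @ [])"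
    by (intro word_eq_append word_eq.refl word_eq_right_inverse)
  moreover have "word_eq ((inv_word u @ u) @ inv_word v) (inv_word u @ v @ inv_word v)"
    using word_eq_context[OF assms, of "inv_word u" "inv_word v"] by simp
  moreover have "word_eq ((inv_word u @ u) @ inv_word v) ([] @ inv_word v)"
    by (intro word_eq_append word_eq.refl word_eq_left_inverse)
  ultimately show ?thesis
    by (metis append_Nil append_Nil2 word_eq.sym word_eq.trans)
qed

instantiation bullet :: "{monoid_mult, inverse}"
begin

lift_definition one_bullet :: bullet is "[]" .

lift_definition times_bullet :: "bullet \<Rightarrow> bullet \<Rightarrow> bullet" is "(@)"
  by (rule word_eq_append)

lift_definition inverse_bullet :: "bullet \<Rightarrow> bullet" is inv_word
  by (rule inv_word_cong)

definition divide_bullet :: "bullet \<Rightarrow> bullet \<Rightarrow> bullet" where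
  "divide_bullet x y = x * inverse y"

instance
  by standard (transfer, simp add: word_eq.refl)+

end

interpretation bullet: group "(*) :: bullet \<Rightarrow> bullet \<Rightarrow> bullet" 1 inverse
  by standard (simp, transfer, rule word_eq_left_inverse)

lift_definition sigma :: "nat \<Rightarrow> bullet" is "\<lambda>i. [(Sig i, True)]" .

lift_definition alpha :: "nat \<Rightarrow> bullet" is "\<lambda>i. [(Alp i, True)]" .

inductive_set positive :: "bullet set" where
  one: "1 \<in> positive"
| sigma: "sigma i \<in> positive"
| alpha: "alpha i \<in> positive"
| mult: "x \<in> positive \<Longrightarrow> y \<in> positive \<Longrightarrow> x * y \<in> positive"

fun shift_gen :: "gen \<Rightarrow> gen" where
  "shift_gen (Sig i) = Sig (Suc i)"
| "shift_gen (Alp i) = Alp (Suc i)"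

lemma bullet_rel_shift: "bullet_rel r s \<Longrightarrow> bullet_rel (map shift_gen r) (map shift_gen s)"
proof (induction rule: bullet_rel.induct)
  case (alp_alp j i)
  then show ?case using bullet_rel.alp_alp[of "Suc i" "Suc j"] by (cases j) auto
next
  case (alp_sig j i)
  then show ?case using bullet_rel.alp_sig[of "Suc i" "Suc j"] by (cases j) auto
qed (use bullet_rel.intros in fastforce)+

text \<open>The endomorphism \<open>\<partial>\<close>.\<close>

lift_definition shift :: "bullet \<Rightarrow> bullet" is "map (map_prod shift_gen id)"
proof -
  fix u v :: word
  assume "word_eq u v"
  then show "word_eq (map (map_prod shift_gen id) u) (map (map_prod shift_gen id) v)"
  proof (induction rule: word_eq.induct)
    case (rel r s u v)
    then show ?case
      using word_eq.rel[OF bullet_rel_shift[OF rel]] by (simp add: comp_def)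
  qed (auto intro: word_eq.intros)
qed

lemma shift_one: "shift 1 = 1"
  by transfer (simp add: word_eq.refl)

lemma shift_mult: "shift (x * y) = shift x * shift y"
  by transfer (simp add: word_eq.refl)

lemma shift_sigma: "shift (sigma i) = sigma (Suc i)"
  by transfer (simp add: word_eq.refl)

lemma shift_alpha: "shift (alpha i) = alpha (Suc i)"
  by transfer (simp add: word_eq.refl)

definition bracket :: "bullet \<Rightarrow> bullet \<Rightarrow> bullet" where
  "bracket x y = x * shift y * sigma 0 * inverse (shift x)"

definition circ :: "bullet \<Rightarrow> bullet \<Rightarrow> bullet" where
  "circ x y = x * shift y * alpha 0"

inductive_set special_braids :: "bullet set" where
  one: "1 \<in> special_braids"
| bracket: "x \<in> special_braids \<Longrightarrow> y \<in> special_braids \<Longrightarrow> bracket x y \<in> special_braids"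

inductive_set special_thompson :: "bullet set" where
  one: "1 \<in> special_thompson"
| circ: "x \<in> special_thompson \<Longrightarrow> y \<in> special_thompson \<Longrightarrow> circ x y \<in> special_thompson"

inductive_set special_parenthesized_braids :: "bullet set" where
  one: "1 \<in> special_parenthesized_braids"
| bracket: "x \<in> special_parenthesized_braids \<Longrightarrow> y \<in> special_parenthesized_braids
    \<Longrightarrow> bracket x y \<in> special_parenthesized_braids"
| circ: "x \<in> special_parenthesized_braids \<Longrightarrow> y \<in> special_parenthesized_braids
    \<Longrightarrow> circ x y \<in> special_parenthesized_braids"

text \<open>The product \<open>z 0 \<cdot> \<partial> (z 1) \<cdot> \<dots> \<cdot> \<partial>\<^sup>p\<^sup>-\<^sup>1 (z (p - 1))\<close>.\<close>

definition shifted_prod :: "nat \<Rightarrow> (nat \<Rightarrow> bullet) \<Rightarrow> bullet" where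
  "shifted_prod p z = prod_list (map (\<lambda>i. (shift ^^ i) (z i)) [0..<p])"

text \<open>
  As \<open>1\<close> is special, a decomposition can always be lengthened by trailing factors \<open>1\<close>, so that
  the factors can be unique only up to this. We therefore encode the factors of a decomposition
  as an infinite sequence that is \<open>1\<close> from index \<open>p\<close> on; two finite lists of factors give
  the same sequence iff they differ only by trailing \<open>1\<close>s.
\<close>

definition is_special_decomposition :: "bullet \<Rightarrow> (nat \<Rightarrow> bullet) \<Rightarrow> bool" where
  "is_special_decomposition x z \<longleftrightarrow>
     (\<forall>i. z i \<in> special_parenthesized_braids) \<and>
     (\<exists>p. (\<forall>i\<ge>p. z i = 1) \<and> x = shifted_prod p z)"

definition is_braid_thompson_decomposition ::
  "bullet \<Rightarrow> (nat \<Rightarrow> bullet) \<Rightarrow> (nat \<Rightarrow> bullet) \<Rightarrow> bool" where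
  "is_braid_thompson_decomposition x \<beta> h \<longleftrightarrow>
     (\<forall>i. \<beta> i \<in> special_braids) \<and> (\<forall>i. h i \<in> special_thompson) \<and>
     (\<exists>n. (\<forall>i\<ge>n. \<beta> i = 1 \<and> h i = 1) \<and> x = shifted_prod n \<beta> * shifted_prod n h)"

end

theory Submission
  imports Defs
begin

text \<open>
  Existence holds since products \<open>z\<^sub>1 \<cdot> \<partial>z\<^sub>2 \<cdot> \<dots>\<close> are stable under right multiplication by the generators:
  \<open>x \<cdot> \<partial>y \<cdot> \<sigma>\<^sub>1 = x\<lceil>y\<rceil> \<cdot> \<partial>x\<close> and \<open>x \<cdot> \<partial>y \<cdot> a\<^sub>1 = x \<circ> y\<close>, while \<open>\<partial>\<^sup>2z\<close> commutes with \<open>\<sigma>\<^sub>1\<close> and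
  \<open>\<partial>\<^sup>2z \<cdot> a\<^sub>1 = a\<^sub>1 \<cdot> \<partial>z\<close>; moreover every letter \<open>a\<^sub>i\<close> can be moved to the right of every \<open>\<sigma>\<^sub>j\<close>.

  For uniqueness, the laws \<open>(x \<circ> y)\<lceil>z\<rceil> = x\<lceil>y\<lceil>z\<rceil>\<rceil>\<close> and \<open>x\<lceil>y \<circ> z\<rceil> = x\<lceil>y\<rceil> \<circ> x\<lceil>z\<rceil>\<close> write a special parenthesized
  braid as a binary \<open>\<circ>\<close>-tree with special braids at its leaves, which reduces the first decomposition to
  the second. The group acts on sequences of colours, with \<open>\<sigma>\<^sub>i\<close> acting by conjugation and \<open>a\<^sub>i\<close> by gluing
  two colours. On a constant integer sequence the braids act trivially and the trees are read off from the
  result, so the Thompson parts agree. For the braid parts, the bracket is left self-distributive, hence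
  (Dehornoy) any two distinct special braids \<open>x, y\<close> are comparable for iterated left division, which makes
  \<open>x\<^sup>-\<^sup>1y\<close> or \<open>y\<^sup>-\<^sup>1x\<close> a \<open>\<sigma>\<^sub>1\<close>-positive braid; and (Larue) such a braid acts nontrivially on a free group,
  since it sends \<open>x\<^sub>1\<close> to a reduced word that ends with \<open>x\<^sub>1\<^sup>-\<^sup>1\<close>.
\<close>

section \<open>The augmented left-distributive laws\<close>

lemma sigma_commute: "j \<ge> i + 2 \<Longrightarrow> sigma j * sigma i = sigma i * sigma j"
  by transfer (use word_eq.sym[OF word_eq.rel[OF bullet_rel.sig_sig, of _ _ "[]" "[]"]] in simp)

lemma alpha_sigma_commute: "j \<ge> i + 2 \<Longrightarrow> alpha j * sigma i = sigma i * alpha j"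
  by transfer (use word_eq.sym[OF word_eq.rel[OF bullet_rel.sig_alp, of _ _ "[]" "[]"]] in simp)

lemma alpha_alpha: "j > i \<Longrightarrow> alpha (Suc j) * alpha i = alpha i * alpha j"
  by transfer (use word_eq.sym[OF word_eq.rel[OF bullet_rel.alp_alp, of _ "Suc _" "[]" "[]"]] in simp)

lemma sigma_alpha: "j > i \<Longrightarrow> sigma (Suc j) * alpha i = alpha i * sigma j"
  by transfer (use word_eq.sym[OF word_eq.rel[OF bullet_rel.alp_sig, of _ "Suc _" "[]" "[]"]] in simp)

lemma sigma_braid: "sigma i * (sigma (Suc i) * sigma i) = sigma (Suc i) * (sigma i * sigma (Suc i))"
  by transfer (use word_eq.rel[OF bullet_rel.braid, of "[]" _ "[]"] in simp)

lemma alpha_sigma_same: "alpha i * sigma i = sigma (Suc i) * (sigma i * alpha (Suc i))"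
  by transfer (use word_eq.sym[OF word_eq.rel[OF bullet_rel.sig_sig_alp, of "[]" _ "[]"]] in simp)

lemma alpha_Suc_sigma: "alpha (Suc i) * sigma i = sigma i * (sigma (Suc i) * alpha i)"
  by transfer (use word_eq.sym[OF word_eq.rel[OF bullet_rel.sig_sig_alp', of "[]" _ "[]"]] in simp)

lemma shift_inverse: "shift (inverse x) = inverse (shift x)"
  by (metis bullet.inverse_unique bullet.right_inverse shift_mult shift_one)

lemma funpow_shift_one: "(shift ^^ n) 1 = 1"
  by (induction n) (simp_all add: shift_one)

lemma funpow_shift_mult: "(shift ^^ n) (x * y) = (shift ^^ n) x * (shift ^^ n) y"
  by (induction n) (simp_all add: shift_mult)

lemma inverse_mult_cancel [simp]:
  fixes x y :: bullet
  shows "inverse x * (x * y) = y" "x * (inverse x * y) = y"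
  by (simp_all flip: mult.assoc)

text \<open>The letters of a representing word are generators or their inverses. This carries
  commutation with shifted elements from the generators to the whole group.\<close>

lemma bullet_induct [case_names one sigma alpha inverse mult]:
  assumes "P 1" "\<And>i. P (sigma i)" "\<And>i. P (alpha i)"
    and inv: "\<And>x. P x \<Longrightarrow> P (inverse x)" and mult: "\<And>x y. P x \<Longrightarrow> P y \<Longrightarrow> P (x * y)"
  shows "P x"
proof -
  have "P (abs_bullet w)" for w
  proof (induction w)
    case Nil
    show ?case using assms(1) by (simp add: one_bullet_def)
  next
    case (Cons c w)
    obtain g b where c: "c = (g, b)" by (cases c)
    have gen: "P (abs_bullet [(g, True)])"
      using assms(2,3) by (cases g) (simp_all flip: sigma.abs_eq alpha.abs_eq)
    have "abs_bullet [(g, False)] = inverse (abs_bullet [(g, True)])"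
      by (simp add: inverse_bullet.abs_eq inv_word_def)
    with gen inv have "P (abs_bullet [c])"
      by (cases b) (simp_all add: c)
    moreover have "abs_bullet (c # w) = abs_bullet [c] * abs_bullet w"
      by (simp add: times_bullet.abs_eq)
    ultimately show ?case using Cons mult by simp
  qed
  then show ?thesis by (metis Quotient_abs_rep Quotient_bullet)
qed

lemma commute_inverse:
  fixes u v a :: bullet
  assumes "u * a = a * v"
  shows "inverse u * a = a * inverse v"
  using assms by (metis bullet.right_inverse inverse_mult_cancel mult.assoc mult.right_neutral)

lemma shift_shift_sigma: "shift (shift x) * sigma 0 = sigma 0 * shift (shift x)"
proof (induction x rule: bullet_induct)
  case (inverse x)
  then show ?case unfolding shift_inverse by (rule commute_inverse)
next
  case (mult x y)
  then show ?case by (metis mult.assoc shift_mult)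
qed (simp_all add: shift_one shift_sigma shift_alpha sigma_commute alpha_sigma_commute)

lemma shift_shift_alpha: "shift (shift x) * alpha 0 = alpha 0 * shift x"
proof (induction x rule: bullet_induct)
  case (inverse x)
  then show ?case unfolding shift_inverse by (rule commute_inverse)
next
  case (mult x y)
  then show ?case by (metis mult.assoc shift_mult)
qed (simp_all add: shift_one shift_sigma shift_alpha sigma_alpha alpha_alpha)

lemma shift_shift_sigma': "shift (shift x) * (sigma 0 * y) = sigma 0 * (shift (shift x) * y)"
  by (metis mult.assoc shift_shift_sigma)

lemma shift_shift_alpha': "shift (shift x) * (alpha 0 * y) = alpha 0 * (shift x * y)"
  by (metis mult.assoc shift_shift_alpha)

lemma inverse_shift_shift_sigma:
  "inverse (shift (shift x)) * (sigma 0 * y) = sigma 0 * (inverse (shift (shift x)) * y)"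
  using shift_shift_sigma'[of "inverse x" y] by (simp add: shift_inverse)

lemmas shift_simps = shift_one shift_mult shift_sigma shift_alpha shift_inverse
  bullet.inverse_distrib_swap mult.assoc

lemma bracket_bracket: "bracket x (bracket y z) = bracket (bracket x y) (bracket x z)"
proof -
  \<comment> \<open>The braid relation with its last \<open>sigma (Suc 0)\<close> moved across. It
    is all that remains of the identity once doubly shifted factors are moved past
    \<open>sigma 0\<close>.\<close>
  have "sigma 0 * (sigma (Suc 0) * (sigma 0 * (inverse (sigma (Suc 0)) * r))) =
      sigma (Suc 0) * (sigma 0 * r)" for r
    using arg_cong[OF sigma_braid[of 0], of "\<lambda>t. t * (inverse (sigma (Suc 0)) * r)"]
    by (simp add: mult.assoc)
  then show ?thesis
    by (simp add: bracket_def shift_simps inverse_shift_shift_sigma flip: shift_shift_sigma')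
qed

lemma bracket_circ_left: "bracket (circ x y) z = bracket x (bracket y z)"
proof -
  \<comment> \<open>The relation \<open>alpha_sigma_same\<close> with \<open>alpha (Suc 0)\<close>
    moved across; that inverse comes from \<open>inverse (shift (circ x y))\<close>.\<close>
  have "alpha 0 * (sigma 0 * (inverse (alpha (Suc 0)) * r)) = sigma (Suc 0) * (sigma 0 * r)" for r
    using arg_cong[OF alpha_sigma_same[of 0], of "\<lambda>t. t * (inverse (alpha (Suc 0)) * r)"]
    by (simp add: mult.assoc)
  then show ?thesis
    by (simp add: bracket_def circ_def shift_simps inverse_shift_shift_sigma shift_shift_sigma'
        flip: shift_shift_alpha')
qed

lemma bracket_circ_right: "bracket x (circ y z) = circ (bracket x y) (bracket x z)"
proof -
  have "alpha (Suc 0) * (sigma 0 * r) = sigma 0 * (sigma (Suc 0) * (alpha 0 * r))" for r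
    using arg_cong[OF alpha_Suc_sigma[of 0], of "\<lambda>t. t * r"] by (simp add: mult.assoc)
  moreover have "inverse (shift (shift x)) * alpha 0 = alpha 0 * inverse (shift x)"
    by (rule commute_inverse) (rule shift_shift_alpha)
  ultimately show ?thesis
    by (simp add: bracket_def circ_def shift_simps shift_shift_sigma')
qed

section \<open>Comparison in monogenerated left-distributive systems\<close>

datatype ldterm = X | App ldterm ldterm

text \<open>Left distributivity used in the expanding direction only, which makes a confluence
  argument possible.\<close>

inductive expand :: "ldterm \<Rightarrow> ldterm \<Rightarrow> bool" where
  same: "expand t t"
| chain: "expand t u \<Longrightarrow> expand u v \<Longrightarrow> expand t v"
| app: "expand t t' \<Longrightarrow> expand u u' \<Longrightarrow> expand (App t u) (App t' u')"
| dist: "expand (App t (App u v)) (App (App t u) (App t v))"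

fun distrib :: "ldterm \<Rightarrow> ldterm \<Rightarrow> ldterm" where
  "distrib t X = App t X"
| "distrib t (App u v) = App (distrib t u) (distrib t v)"

text \<open>Dehornoy's derivation on terms: it distributes everything at once and so dominates every
  single use of distributivity.\<close>

fun full :: "ldterm \<Rightarrow> ldterm" where
  "full X = X"
| "full (App t u) = distrib (full t) (full u)"

lemma expand_distrib: "expand (App t u) (distrib t u)"
proof (induction u)
  case (App u v)
  then show ?case using expand.chain[OF expand.dist expand.app] by simp
qed (simp add: expand.same)

lemma distrib_mono_left: "expand t t' \<Longrightarrow> expand (distrib t u) (distrib t' u)"
  by (induction u) (auto intro: expand.app expand.same)

lemma distrib_mono_right: "expand u u' \<Longrightarrow> expand (distrib t u) (distrib t u')"
  by (induction rule: expand.induct) (auto intro: expand.intros)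

lemma distrib_mono: "expand t t' \<Longrightarrow> expand u u' \<Longrightarrow> expand (distrib t u) (distrib t' u')"
  by (blast intro: expand.chain distrib_mono_left distrib_mono_right)

lemma distrib_distrib: "expand (distrib t (distrib u v)) (distrib (distrib t u) (distrib t v))"
proof (induction v)
  case X
  show ?case using expand_distrib[of "distrib t u" "distrib t X"] by simp
qed (simp add: expand.app)

lemma full_mono: "expand t u \<Longrightarrow> expand (full t) (full u)"
  by (induction rule: expand.induct) (auto intro: expand.same expand.chain distrib_mono distrib_distrib)

lemma expand_full: "expand t (full t)"
proof (induction t)
  case (App t u)
  then show ?case using expand.chain[OF expand.app expand_distrib] by simp
qed (simp add: expand.same)

lemma funpow_full_mono: "expand t u \<Longrightarrow> expand ((full ^^ n) t) ((full ^^ n) u)"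
  by (induction n) (auto intro: full_mono)

lemma funpow_full_le: "m \<le> n \<Longrightarrow> expand ((full ^^ m) t) ((full ^^ n) t)"
  by (induction n rule: dec_induct) (simp_all add: expand.same expand.chain[OF _ expand_full])

lemma funpow_full_app: "expand (App ((full ^^ n) t) ((full ^^ n) u)) ((full ^^ n) (App t u))"
proof (induction n)
  case (Suc n)
  have "expand (App ((full ^^ Suc n) t) ((full ^^ Suc n) u)) (full (App ((full ^^ n) t) ((full ^^ n) u)))"
    using expand_distrib by simp
  moreover have "expand (full (App ((full ^^ n) t) ((full ^^ n) u))) ((full ^^ Suc n) (App t u))"
    using full_mono[OF Suc] by simp
  ultimately show ?case by (rule expand.chain)
qed (simp add: expand.same)

text \<open>The iterates of \<open>full\<close> form an increasing chain, here shown cofinal among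
  the expansions of \<open>t\<close>. Confluence follows, since two expansions both lie below the
  larger iterate.\<close>

lemma expand_funpow_full: "expand t u \<Longrightarrow> \<exists>n. expand u ((full ^^ n) t)"
proof (induction rule: expand.induct)
  case (same t)
  show ?case by (metis expand_full funpow.simps(2) funpow_0 o_apply expand.same)
next
  case (chain t u v)
  then obtain m n where "expand u ((full ^^ m) t)" "expand v ((full ^^ n) u)" by blast
  then have "expand v ((full ^^ (n + m)) t)"
    by (metis comp_apply expand.chain funpow_add funpow_full_mono)
  then show ?case ..
next
  case (app t t' u u')
  then obtain m n where mn: "expand t' ((full ^^ m) t)" "expand u' ((full ^^ n) u)" by blast
  have "expand (App t' u') (App ((full ^^ max m n) t) ((full ^^ max m n) u))"
    using mn by (meson expand.app expand.chain funpow_full_le max.cobounded1 max.cobounded2)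
  then show ?case using expand.chain funpow_full_app by blast
next
  case (dist t u v)
  have "expand (App (App t u) (App t v)) (full (App t (App u v)))"
  proof -
    have "expand (App (App t u) (App t v)) (App (full (App t u)) (full (App t v)))"
      by (intro expand.app expand_full)
    also have "\<dots> = distrib (full t) (App (full u) (full v))" by simp
    finally have "expand (App (App t u) (App t v)) (distrib (full t) (App (full u) (full v)))" .
    moreover have "expand (distrib (full t) (App (full u) (full v))) (full (App t (App u v)))"
      unfolding full.simps by (intro distrib_mono_right expand_distrib)
    ultimately show ?thesis by (rule expand.chain)
  qed
  then show ?case by (intro exI[of _ 1]) simp
qed

lemma expand_confluent:
  assumes "expand t u" "expand t v"
  shows "\<exists>w. expand u w \<and> expand v w"
proof -
  obtain m n where "expand u ((full ^^ m) t)" "expand v ((full ^^ n) t)"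
    using assms expand_funpow_full by blast
  then have "expand u ((full ^^ max m n) t)" "expand v ((full ^^ max m n) t)"
    by (meson expand.chain funpow_full_le max.cobounded1 max.cobounded2)+
  then show ?thesis by blast
qed

section \<open>Left-distributive equivalence and comparability of terms\<close>

definition ld_eq :: "ldterm \<Rightarrow> ldterm \<Rightarrow> bool" where
  "ld_eq t u \<longleftrightarrow> (\<exists>w. expand t w \<and> expand u w)"

lemma ld_eq_refl: "ld_eq t t"
  unfolding ld_eq_def using expand.same by blast

lemma ld_eq_sym: "ld_eq t u \<Longrightarrow> ld_eq u t"
  unfolding ld_eq_def by blast

lemma ld_eq_trans [trans]: "ld_eq t u \<Longrightarrow> ld_eq u v \<Longrightarrow> ld_eq t v"
  unfolding ld_eq_def by (meson expand.chain expand_confluent)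

lemma ld_eq_app: "ld_eq t t' \<Longrightarrow> ld_eq u u' \<Longrightarrow> ld_eq (App t u) (App t' u')"
  unfolding ld_eq_def using expand.app by blast

lemma ld_eq_dist: "ld_eq (App t (App u v)) (App (App t u) (App t v))"
  unfolding ld_eq_def using expand.dist expand.same by blast

fun right_power :: "nat \<Rightarrow> ldterm" where
  "right_power 0 = X"
| "right_power (Suc n) = App X (right_power n)"

text \<open>
  So for any \<open>t\<close> and \<open>u\<close> there is a term \<open>p\<close> such that \<open>App t p\<close> and \<open>App u p\<close> have a common
  expansion, which makes \<open>t\<close> and \<open>u\<close> comparable.
\<close>

lemma absorption: "\<exists>m. \<forall>n\<ge>m. ld_eq (App t (right_power n)) (right_power (Suc n))"
proof (induction t)
  case X
  show ?case by (auto simp: ld_eq_refl)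
next
  case (App t u)
  then obtain m m' where
    t: "\<And>n. n \<ge> m \<Longrightarrow> ld_eq (App t (right_power n)) (right_power (Suc n))" and
    u: "\<And>n. n \<ge> m' \<Longrightarrow> ld_eq (App u (right_power n)) (right_power (Suc n))" by blast
  have "ld_eq (App (App t u) (right_power n)) (right_power (Suc n))"
    if n: "n \<ge> Suc (max m m')" for n
  proof -
    obtain k where k: "n = Suc k" "k \<ge> m" "k \<ge> m'" using n by (cases n) auto
    \<comment> \<open>One factor \<open>X\<close> is traded for \<open>t\<close>, so that
      distributivity can be undone; this costs one power, hence the bound
      \<open>Suc (max m m')\<close>.\<close>
    have "ld_eq (App (App t u) (right_power n)) (App (App t u) (App t (right_power k)))"
      unfolding k(1) by (intro ld_eq_app ld_eq_refl ld_eq_sym[OF t] k)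
    also have "ld_eq \<dots> (App t (App u (right_power k)))"
      by (rule ld_eq_sym[OF ld_eq_dist])
    also have "ld_eq \<dots> (App t (right_power n))"
      unfolding k(1) by (intro ld_eq_app ld_eq_refl u k)
    also have "ld_eq \<dots> (right_power (Suc n))"
      using k by (intro t) simp
    finally show ?thesis .
  qed
  then show ?case by blast
qed

inductive left_subterm :: "ldterm \<Rightarrow> ldterm \<Rightarrow> bool" where
  whole: "left_subterm t t"
| app: "left_subterm s t \<Longrightarrow> left_subterm s (App t u)"

inductive_cases left_subterm_appE: "left_subterm s (App t u)"

text \<open>The iterated left subterms of a term are the nodes of its leftmost branch, which are
  linearly ordered.\<close>

lemma left_subterm_total:
  "left_subterm s u \<Longrightarrow> left_subterm t u \<Longrightarrow> left_subterm s t \<or> left_subterm t s"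
  by (induction arbitrary: t rule: left_subterm.induct)
    (auto intro: left_subterm.intros elim: left_subterm_appE)

text \<open>Distributivity only pushes the left factor further down the leftmost branch:
  \<open>t\<close> in \<open>App t (App u v)\<close> becomes the left factor of
  \<open>App t u\<close>.\<close>

lemma expand_left_subterm:
  "expand t u \<Longrightarrow> left_subterm s t \<Longrightarrow> \<exists>s'. left_subterm s' u \<and> expand s s'"
proof (induction arbitrary: s rule: expand.induct)
  case (same t)
  then show ?case using expand.same by blast
next
  case (chain t u v)
  then show ?case by (meson expand.chain)
next
  case (app t t' u u')
  from app.prems show ?case
  proof (rule left_subterm_appE)
    assume "App t u = s"
    then show ?thesis using app.hyps expand.app left_subterm.whole by blast
  next
    assume "left_subterm s t"
    then show ?thesis using app.IH left_subterm.app by blast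
  qed
next
  case (dist t u v)
  then show ?case
  proof (rule left_subterm_appE)
    assume "App t (App u v) = s"
    then show ?thesis using expand.dist left_subterm.whole by blast
  next
    assume "left_subterm s t"
    then show ?thesis using expand.same left_subterm.app by blast
  qed
qed

context
  fixes opr :: "'a \<Rightarrow> 'a \<Rightarrow> 'a" and e :: 'a
  assumes left_distrib: "opr x (opr y z) = opr (opr x y) (opr x z)"
begin

fun ld_value :: "ldterm \<Rightarrow> 'a" where
  "ld_value X = e"
| "ld_value (App t u) = opr (ld_value t) (ld_value u)"

lemma ld_value_expand: "expand t u \<Longrightarrow> ld_value t = ld_value u"
  by (induction rule: expand.induct) (simp_all flip: left_distrib)

lemma ld_value_left_subterm:
  "left_subterm t u \<Longrightarrow> (\<lambda>x y. \<exists>z\<in>range ld_value. y = opr x z)\<^sup>*\<^sup>* (ld_value t) (ld_value u)"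
  by (induction rule: left_subterm.induct) (auto intro: rtranclp.rtrancl_into_rtrancl)

lemma left_division_total:
  "(\<lambda>x y. \<exists>z\<in>range ld_value. y = opr x z)\<^sup>*\<^sup>* (ld_value t) (ld_value u) \<or>
   (\<lambda>x y. \<exists>z\<in>range ld_value. y = opr x z)\<^sup>*\<^sup>* (ld_value u) (ld_value t)"
proof -
  obtain m n where
    "\<forall>k\<ge>m. ld_eq (App t (right_power k)) (right_power (Suc k))"
    "\<forall>k\<ge>n. ld_eq (App u (right_power k)) (right_power (Suc k))"
    using absorption by blast
  then have "ld_eq (App t (right_power (max m n))) (App u (right_power (max m n)))"
    by (meson ld_eq_sym ld_eq_trans max.cobounded1 max.cobounded2)
  then obtain w where w: "expand (App t (right_power (max m n))) w"
    "expand (App u (right_power (max m n))) w"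
    by (auto simp: ld_eq_def)
  \<comment> \<open>As left factors of terms expanding to \<open>w\<close>, both \<open>t\<close>
    and \<open>u\<close> have expansions on the leftmost branch of \<open>w\<close>.\<close>
  obtain t' u' where sub: "left_subterm t' w" "left_subterm u' w" and exp: "expand t t'" "expand u u'"
    using w by (meson expand_left_subterm left_subterm.intros)
  show ?thesis
    using left_subterm_total[OF sub] ld_value_left_subterm
    unfolding ld_value_expand[OF exp(1)] ld_value_expand[OF exp(2)] by blast
qed

end

section \<open>Free groups and the Artin substitutions\<close>

definition flip :: "nat \<times> bool \<Rightarrow> nat \<times> bool" where
  "flip c = (fst c, \<not> snd c)"

lemma flip_flip [simp]: "flip (flip c) = c"
  by (simp add: flip_def)

lemma fst_flip [simp]: "fst (flip c) = fst c"
  by (simp add: flip_def)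

lemma flip_neq [simp]: "flip c \<noteq> c" "c \<noteq> flip c"
  by (simp_all add: flip_def prod_eq_iff)

fun push :: "nat \<times> bool \<Rightarrow> (nat \<times> bool) list \<Rightarrow> (nat \<times> bool) list" where
  "push c [] = [c]"
| "push c (d # w) = (if d = flip c then w else c # d # w)"

definition red :: "(nat \<times> bool) list \<Rightarrow> (nat \<times> bool) list" where
  "red w = foldr push w []"

abbreviation reduced :: "(nat \<times> bool) list \<Rightarrow> bool" where
  "reduced \<equiv> successively (\<lambda>c d. d \<noteq> flip c)"

lemma red_simps [simp]: "red [] = []" "red (c # w) = push c (red w)"
  by (simp_all add: red_def)

lemma push_eq: "push c w = (if w \<noteq> [] \<and> hd w = flip c then tl w else c # w)"
  by (cases w) auto

lemma reduced_push: "reduced w \<Longrightarrow> reduced (push c w)"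
  by (cases w) (auto simp: successively_Cons neq_Nil_conv)

lemma push_push_flip: "reduced w \<Longrightarrow> push c (push (flip c) w) = w"
  by (cases w rule: remdups_adj.cases) auto

lemma reduced_foldr_push: "reduced w \<Longrightarrow> reduced (foldr push u w)"
  by (induction u) (auto intro: reduced_push)

lemma reduced_red: "reduced (red w)"
  by (simp add: red_def reduced_foldr_push)

lemma foldr_push_push: "reduced w \<Longrightarrow> foldr push (push c u) w = push c (foldr push u w)"
  by (cases u) (auto simp: push_push_flip reduced_foldr_push)

text \<open>Van der Waerden's trick: letters act on reduced words by mutually inverse pushes, so a
  word acts as its reduced form does.\<close>

lemma foldr_push_red: "reduced w \<Longrightarrow> foldr push (red u) w = foldr push u w"
  by (induction u) (auto simp: foldr_push_push)

lemma red_append: "red (u @ v) = foldr push u (red v)"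
  by (simp add: red_def)

lemma red_append_cong: "red u = red u' \<Longrightarrow> red v = red v' \<Longrightarrow> red (u @ v) = red (u' @ v')"
  by (metis foldr_push_red red_append reduced_red)

definition winv :: "(nat \<times> bool) list \<Rightarrow> (nat \<times> bool) list" where
  "winv w = rev (map flip w)"

lemma winv_winv [simp]: "winv (winv w) = w"
  by (simp add: winv_def rev_map comp_def)

lemma winv_simps [simp]: "winv [] = []" "winv (c # w) = winv w @ [flip c]" "winv (u @ v) = winv v @ winv u"
  by (simp_all add: winv_def)

lemma red_cancel: "red (w @ winv w @ v) = red v"
proof (induction w arbitrary: v)
  case (Cons c w)
  then show ?case using push_push_flip[OF reduced_red] by simp
qed simp

lemma red_winv_left: "red (winv w @ w) = []"
  using red_cancel[of "winv w" "[]"] by simp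

lemma red_winv_cong:
  assumes "red u = red v"
  shows "red (winv u) = red (winv v)"
proof -
  have "red (winv u) = red ((winv u @ v) @ winv v)"
    using red_append_cong[of "winv u" "winv u" "v @ winv v" "[]"] red_cancel[of v "[]"] by simp
  also have "\<dots> = red ((winv u @ u) @ winv v)"
    by (intro red_append_cong) (use assms in simp_all)
  also have "\<dots> = red ([] @ winv v)"
    by (intro red_append_cong) (simp_all add: red_winv_left)
  finally show ?thesis by simp
qed

quotient_type free = "(nat \<times> bool) list" / "\<lambda>u v. red u = red v"
  by (auto intro!: equivpI simp: reflp_def symp_def transp_def)

text \<open>Additive notation for a noncommutative group: the same colour type then serves both free
  groups and the integers.\<close>

instantiation free :: group_add
begin

lift_definition zero_free :: free is "[]" .
lift_definition plus_free :: "free \<Rightarrow> free \<Rightarrow> free" is "(@)" by (rule red_append_cong)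
lift_definition uminus_free :: "free \<Rightarrow> free" is winv by (rule red_winv_cong)
definition minus_free :: "free \<Rightarrow> free \<Rightarrow> free" where "minus_free x y = x + - y"

instance
proof
  fix a b c :: free
  show "a + b + c = a + (b + c)" by transfer simp
  show "0 + a = a" by transfer simp
  show "- a + a = 0" by transfer (simp add: red_winv_left)
  show "a + 0 = a" by transfer simp
  show "a + - b = a - b" by (simp add: minus_free_def)
qed

end

section \<open>Evaluation of words and substitutions\<close>

definition word_value :: "(nat \<Rightarrow> 'g::group_add) \<Rightarrow> (nat \<times> bool) list \<Rightarrow> 'g" where
  "word_value g w = sum_list (map (\<lambda>c. if snd c then g (fst c) else - g (fst c)) w)"

lemma word_value_simps [simp]:
  "word_value g [] = 0"
  "word_value g (c # w) = (if snd c then g (fst c) else - g (fst c)) + word_value g w"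
  "word_value g (u @ v) = word_value g u + word_value g v"
  by (simp_all add: word_value_def)

lemma word_value_winv [simp]: "word_value g (winv w) = - word_value g w"
  by (induction w) (auto simp: flip_def minus_add)

definition subst :: "(nat \<times> bool \<Rightarrow> (nat \<times> bool) list) \<Rightarrow> (nat \<times> bool) list \<Rightarrow> (nat \<times> bool) list" where
  "subst f w = concat (map f w)"

lemma subst_simps [simp]: "subst f [] = []" "subst f (c # w) = f c @ subst f w"
  "subst f (u @ v) = subst f u @ subst f v"
  by (simp_all add: subst_def)

lemma word_value_subst:
  assumes "\<And>c. f (flip c) = winv (f c)"
  shows "word_value g (subst f w) = word_value (\<lambda>i. word_value g (f (i, True))) w"
proof (induction w)
  case (Cons c w)
  have "f (fst c, False) = winv (f (fst c, True))"
    using assms[of "(fst c, True)"] by (simp add: flip_def)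
  then show ?case using Cons by (cases c; cases "snd c") simp_all
qed simp

lemma subst_winv:
  assumes "\<And>c. f (flip c) = winv (f c)"
  shows "subst f (winv w) = winv (subst f w)"
  by (induction w) (simp_all add: assms)

lemma red_subst_red:
  assumes f: "\<And>c. f (flip c) = winv (f c)"
  shows "red (subst f (red w)) = red (subst f w)"
proof (induction w)
  case (Cons c w)
  have "red (subst f (push c v)) = red (f c @ subst f v)" for v
    using f red_cancel by (cases v) auto
  also have "red (f c @ subst f (red w)) = red (f c @ subst f w)"
    by (intro red_append_cong) (simp_all add: Cons)
  finally show ?case by simp
qed simp

lemma word_value_free: "word_value (\<lambda>i. abs_free [(i, True)]) w = abs_free w"
proof (induction w)
  case (Cons c w)
  then show ?case
    by (cases c; cases "snd c")
      (auto simp: plus_free.abs_eq uminus_free.abs_eq flip_def)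
qed (simp add: zero_free_def)

text \<open>
  With signed letters, one substitution covers both signs of a braid generator: \<open>\<sigma>\<^sub>i\<close> corresponds to
  \<open>(a, b) = (x\<^sub>i, x\<^sub>i\<^sub>+\<^sub>1)\<close>, its inverse to \<open>(a, b) = (x\<^sub>i\<^sub>+\<^sub>1\<^sup>-\<^sup>1, x\<^sub>i\<^sup>-\<^sup>1)\<close>.
\<close>

definition artin_subst :: "nat \<times> bool \<Rightarrow> nat \<times> bool \<Rightarrow> nat \<times> bool \<Rightarrow> (nat \<times> bool) list" where
  "artin_subst a b c =
    (if c = a then [a, b, flip a] else if c = flip a then [a, flip b, flip a]
     else if c = b then [a] else if c = flip b then [flip a] else [c])"

lemma artin_subst_flip:
  assumes "fst a \<noteq> fst b"
  shows "artin_subst a b (flip c) = winv (artin_subst a b c)"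
proof -
  have "flip c = d \<longleftrightarrow> c = flip d" for d by (metis flip_flip)
  then show ?thesis using assms by (auto simp: artin_subst_def)
qed

text \<open>
  Larue's argument: the first letter of the reduced form of an image is controlled by the first
  letter of the reduced argument. The case distinction is what an induction on the argument needs.
\<close>

definition head_shape :: "nat \<times> bool \<Rightarrow> nat \<times> bool \<Rightarrow> nat \<times> bool \<Rightarrow> (nat \<times> bool) list \<Rightarrow> bool" where
  "head_shape a b c r \<longleftrightarrow>
    (if c = a then \<exists>r'. r = a # b # r'
     else if c = flip a then \<exists>r'. r = a # flip b # r'
     else if c = b then \<exists>r'. r = a # r' \<and> (r' = [] \<or> hd r' \<notin> {b, flip b, flip a})
     else if c = flip b then r \<noteq> [] \<and> hd r \<in> {flip a, b, flip b}
     else \<exists>r'. r = c # r')"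

lemma head_shape_subst:
  assumes ab: "fst a \<noteq> fst b"
  shows "reduced (c # w) \<Longrightarrow> head_shape a b c (red (subst (artin_subst a b) (c # w)))"
proof -
  have neq: "a \<noteq> b" "b \<noteq> a" "a \<noteq> flip b" "b \<noteq> flip a"
    "flip a \<noteq> b" "flip b \<noteq> a" "flip a \<noteq> flip b" "flip b \<noteq> flip a"
    using ab by (metis fst_flip)+
  have flip_eq: "flip c = d \<longleftrightarrow> c = flip d" for c d by (metis flip_flip)
  show "reduced (c # w) \<Longrightarrow> ?thesis"
  proof (induction w arbitrary: c)
    case Nil
    show ?case using neq by (auto simp: head_shape_def artin_subst_def flip_eq)
  next
    case (Cons d w)
    \<comment> \<open>Since \<open>d \<noteq> flip c\<close>, putting the image of \<open>c\<close>
      in front of \<open>r\<close> cancels at most a leading \<open>a\<close> of \<open>r\<close>;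
      the shape of \<open>r\<close> then rules out further cancellation.\<close>
    define r where "r = red (subst (artin_subst a b) (d # w))"
    have hd: "head_shape a b d r" "d \<noteq> flip c"
      using Cons by (simp_all add: r_def)
    moreover have "red (subst (artin_subst a b) (c # d # w)) = foldr push (artin_subst a b c) r"
      by (simp only: r_def subst_simps(2) red_append)
    moreover consider "c = a" | "c = flip a" | "c = b" | "c = flip b" | "c \<notin> {a, flip a, b, flip b}"
      by blast
    then have "head_shape a b c (foldr push (artin_subst a b c) r)"
    proof cases
      case 1
      with hd show ?thesis using neq by (auto simp: head_shape_def artin_subst_def push_eq split: if_splits)
    next
      case 2
      with hd show ?thesis using neq by (auto simp: head_shape_def artin_subst_def push_eq split: if_splits)
    next
      case 3
      with hd show ?thesis using neq by (auto simp: head_shape_def artin_subst_def push_eq split: if_splits)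
    next
      case 4
      with hd show ?thesis using neq by (auto simp: head_shape_def artin_subst_def push_eq split: if_splits)
    next
      case 5
      with hd show ?thesis using neq by (auto simp: head_shape_def artin_subst_def push_eq flip_eq split: if_splits)
    qed
    ultimately show ?case by simp
  qed
qed

text \<open>Applied to the image of the letter \<open>(0, False)\<close>, this says that the reduced
  image of \<open>(0, True)\<close> ends with \<open>(0, False)\<close>.\<close>

definition starts :: "(nat \<times> bool) list \<Rightarrow> bool" where
  "starts w \<longleftrightarrow> (\<exists>r. red w = (0, True) # r)"

text \<open>The hypotheses leave two cases: \<open>a = (0, True)\<close>, where the image starts
  with \<open>a\<close>, or neither \<open>a\<close> nor \<open>b\<close> has index 0, where the
  first letter is kept. The inverse of \<open>sigma 0\<close> is excluded.\<close>

lemma starts_artin_subst: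
  assumes "fst a \<noteq> fst b" "a \<noteq> (0, False)" "b \<noteq> (0, True)" "b \<noteq> (0, False)" "starts w"
  shows "starts (subst (artin_subst a b) w)"
proof -
  obtain r where r: "red w = (0, True) # r" using assms by (auto simp: starts_def)
  have "head_shape a b (0, True) (red (subst (artin_subst a b) (red w)))"
    unfolding r by (rule head_shape_subst) (use assms reduced_red[of w] in \<open>simp_all add: r\<close>)
  moreover have "red (subst (artin_subst a b) (red w)) = red (subst (artin_subst a b) w)"
    by (rule red_subst_red) (rule artin_subst_flip[OF assms(1)])
  ultimately show ?thesis
    using assms(2-4) by (auto simp: starts_def head_shape_def flip_def prod_eq_iff split: if_splits)
qed

section \<open>The action on sequences of colours\<close>

text \<open>
  The pair \<open>(g, l)\<close> encodes the family \<open>(g\<^sub>v)\<close> of group elements, indexed by the nodes \<open>v\<close> of the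
  infinite binary tree, that satisfies \<open>g\<^sub>v = g\<^sub>v\<^sub>0 + g\<^sub>v\<^sub>1\<close> and has \<open>g\<close> at the root and \<open>l v\<close> at \<open>v0\<close>.
  This freedom below the root makes \<open>node_colour\<close> a bijection, so that the \<open>alpha i\<close> act invertibly.
\<close>

type_synonym 'g colour = "'g \<times> (bool list \<Rightarrow> 'g)"

definition conj_colour :: "'g::group_add \<Rightarrow> 'g colour \<Rightarrow> 'g colour" where
  "conj_colour g y = (g + fst y - g, \<lambda>v. g + snd y v - g)"

definition node_colour :: "'g::group_add colour \<Rightarrow> 'g colour \<Rightarrow> 'g colour" where
  "node_colour x y = (fst x + fst y,
    \<lambda>v. case v of [] \<Rightarrow> fst x | c # v' \<Rightarrow> if c then snd y v' else snd x v')"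

definition left_colour :: "'g::group_add colour \<Rightarrow> 'g colour" where
  "left_colour x = (snd x [], \<lambda>v. snd x (False # v))"

definition right_colour :: "'g::group_add colour \<Rightarrow> 'g colour" where
  "right_colour x = (- snd x [] + fst x, \<lambda>v. snd x (True # v))"

lemma left_right_colour [simp]:
  "left_colour (node_colour x y) = x" "right_colour (node_colour x y) = y"
  "node_colour (left_colour x) (right_colour x) = x"
proof -
  show "node_colour (left_colour x) (right_colour x) = x"
    by (auto simp: node_colour_def left_colour_def right_colour_def prod_eq_iff fun_eq_iff
        simp flip: add.assoc split: list.split)
qed (simp_all add: node_colour_def left_colour_def right_colour_def prod_eq_iff flip: add.assoc)

lemma conj_colour_conj_colour [simp]:
  "conj_colour g (conj_colour h y) = conj_colour (g + h) y"
  by (simp add: conj_colour_def diff_conv_add_uminus minus_add add.assoc del: add_uminus_conv_diff)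

lemma conj_colour_0 [simp]: "conj_colour 0 y = y"
  by (simp add: conj_colour_def)

lemma conj_colour_node [simp]:
  "conj_colour g (node_colour x y) = node_colour (conj_colour g x) (conj_colour g y)"
  by (auto simp: conj_colour_def node_colour_def fun_eq_iff diff_conv_add_uminus minus_add add.assoc
      simp del: add_uminus_conv_diff split: list.split)

lemma fst_conj_colour [simp]: "fst (conj_colour g y) = g + fst y - g"
  by (simp add: conj_colour_def)

lemma fst_node_colour [simp]: "fst (node_colour x y) = fst x + fst y"
  by (simp add: node_colour_def)

text \<open>The Hurwitz action, extended by gluing neighbours. Conjugation uses only the root value,
  and the root of a glued colour is the sum of the two roots, as the mixed relations
  require.\<close>

fun letter_act :: "gen \<times> bool \<Rightarrow> (nat \<Rightarrow> 'g::group_add colour) \<Rightarrow> nat \<Rightarrow> 'g colour" where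
  "letter_act (Sig i, True) s =
    (\<lambda>j. if j = i then conj_colour (fst (s i)) (s (Suc i)) else if j = Suc i then s i else s j)"
| "letter_act (Sig i, False) s =
    (\<lambda>j. if j = i then s (Suc i) else if j = Suc i then conj_colour (- fst (s (Suc i))) (s i) else s j)"
| "letter_act (Alp i, True) s =
    (\<lambda>j. if j < i then s j else if j = i then node_colour (s i) (s (Suc i)) else s (Suc j))"
| "letter_act (Alp i, False) s =
    (\<lambda>j. if j < i then s j else if j = i then left_colour (s i)
      else if j = Suc i then right_colour (s i) else s (j - 1))"

lemma letter_act_cancel: "letter_act (g, \<not> b) (letter_act (g, b) s) = s"
proof (cases g)
  case (Sig i)
  then show ?thesis by (cases b) (auto simp: fun_eq_iff conj_colour_def add.assoc)
next
  case (Alp i)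
  then show ?thesis
    by (cases b) (auto simp: fun_eq_iff not_less le_eq_less_or_eq less_Suc_eq_le)
qed

definition word_act :: "word \<Rightarrow> (nat \<Rightarrow> 'g::group_add colour) \<Rightarrow> nat \<Rightarrow> 'g colour" where
  "word_act w = fold letter_act w"

lemma word_act_simps [simp]: "word_act [] s = s" "word_act (c # w) s = word_act w (letter_act c s)"
  "word_act (u @ v) s = word_act v (word_act u s)"
  by (simp_all add: word_act_def)

lemma word_act_bullet_rel:
  assumes "bullet_rel r t"
  shows "word_act (pos_word r) s = word_act (pos_word t) s"
  using assms
proof cases
  case (sig_sig j i)
  then show ?thesis by (auto simp: fun_eq_iff)
next
  case (sig_alp j i)
  then show ?thesis by (auto simp: fun_eq_iff)
next
  case (alp_alp j i)
  then show ?thesis by (cases j) (auto simp: fun_eq_iff)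
next
  case (alp_sig j i)
  then show ?thesis by (cases j) (auto simp: fun_eq_iff)
next
  case (braid i)
  then show ?thesis by (auto simp: fun_eq_iff)
next
  case (sig_sig_alp i)
  then show ?thesis by (auto simp: fun_eq_iff)
next
  case (sig_sig_alp' i)
  then show ?thesis by (auto simp: fun_eq_iff)
qed

lemma word_act_word_eq: "word_eq u v \<Longrightarrow> word_act u s = word_act v s"
proof (induction arbitrary: s rule: word_eq.induct)
  case (cancel u g b v)
  show ?case by (simp add: letter_act_cancel)
next
  case (rel r t u v)
  then show ?case by (simp add: word_act_bullet_rel)
qed simp_all

lift_definition act :: "bullet \<Rightarrow> (nat \<Rightarrow> 'g::group_add colour) \<Rightarrow> nat \<Rightarrow> 'g colour" is word_act
  by (rule ext) (rule word_act_word_eq)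

lemma act_one [simp]: "act 1 s = s"
  by transfer simp

lemma act_mult [simp]: "act (x * y) s = act y (act x s)"
  by transfer simp

lemma act_inverse [simp]: "act (inverse x) (act x s) = s"
  by (metis act_mult act_one bullet.right_inverse)

lemma act_sigma: "act (sigma i) s = letter_act (Sig i, True) s"
  by transfer simp

lemma act_inverse_sigma: "act (inverse (sigma i)) s = letter_act (Sig i, False) s"
  by transfer (simp add: inv_word_def)

lemma act_alpha: "act (alpha i) s = letter_act (Alp i, True) s"
  by transfer simp

lemma letter_act_shift:
  "letter_act (shift_gen g, b) s = case_nat (s 0) (letter_act (g, b) (\<lambda>i. s (Suc i)))"
  by (cases g; cases b) (auto simp: fun_eq_iff not_less split: nat.split)

lemma act_shift: "act (shift x) s = case_nat (s 0) (act x (\<lambda>i. s (Suc i)))"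
proof transfer
  fix w :: word and s :: "nat \<Rightarrow> 'a colour"
  show "word_act (map (map_prod shift_gen id) w) s = case_nat (s 0) (word_act w (\<lambda>i. s (Suc i)))"
    by (induction w arbitrary: s) (auto simp: letter_act_shift fun_eq_iff split: nat.split)
qed

text \<open>Strips shifts inside the action, so that nontriviality passes from \<open>x\<close> to
  all its shifts.\<close>

lemma act_shift_trivial:
  assumes "\<And>s :: nat \<Rightarrow> 'g::group_add colour. act (shift x) s = s"
  shows "act x (s :: nat \<Rightarrow> 'g colour) = s"
  using assms[of "case_nat (s 0) s"] by (simp add: act_shift fun_eq_iff split: nat.splits)

text \<open>\<open>f\<close> gives the images of signed letters under the substitution by which
  \<open>x\<close> transforms root values. The clause on \<open>starts\<close> carries Larue's
  invariant through products.\<close>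

definition artin :: "bullet \<Rightarrow> (nat \<times> bool \<Rightarrow> (nat \<times> bool) list) \<Rightarrow> bool" where
  "artin x f \<longleftrightarrow> (\<forall>c. f (flip c) = winv (f c)) \<and> (\<forall>w. starts w \<longrightarrow> starts (subst f w)) \<and>
    (\<forall>(s :: nat \<Rightarrow> free colour) i. fst (act x s i) = word_value (\<lambda>i. fst (s i)) (f (i, True)))"

lemma artin_starts: "artin x f \<Longrightarrow> starts w \<Longrightarrow> starts (subst f w)"
  by (simp add: artin_def)

lemma artin_one: "artin 1 (\<lambda>c. [c])"
proof -
  have "subst (\<lambda>c. [c]) w = w" for w by (induction w) simp_all
  then show ?thesis by (simp add: artin_def)
qed

lemma artin_mult:
  assumes "artin x f" "artin y g"
  shows "artin (x * y) (\<lambda>c. subst f (g c))"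
proof -
  have "subst (\<lambda>c. subst f (g c)) w = subst f (subst g w)" for w
    by (induction w) simp_all
  then show ?thesis
    using assms by (simp add: artin_def subst_winv word_value_subst del: split_paired_All)
qed

lemma artin_sigma: "artin (sigma i) (artin_subst (i, True) (Suc i, True))"
  unfolding artin_def
  by (auto simp: artin_subst_flip starts_artin_subst act_sigma)
    (auto simp: artin_subst_def flip_def diff_conv_add_uminus add.assoc simp del: add_uminus_conv_diff)

text \<open>Index 0 must be excluded: the inverse of \<open>sigma 0\<close> sends
  \<open>(0, True)\<close> to \<open>(1, True)\<close> and breaks the invariant.\<close>

lemma artin_inverse_sigma: "i > 0 \<Longrightarrow> artin (inverse (sigma i)) (artin_subst (Suc i, False) (i, False))"
  unfolding artin_def
  by (auto simp: artin_subst_flip starts_artin_subst act_inverse_sigma)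
    (auto simp: artin_subst_def flip_def diff_conv_add_uminus add.assoc simp del: add_uminus_conv_diff)

section \<open>Larue's theorem for \<sigma>-positive braids\<close>

inductive_set braids :: "bullet set" where
  one: "1 \<in> braids"
| sigma: "sigma i \<in> braids"
| inverse: "x \<in> braids \<Longrightarrow> inverse x \<in> braids"
| mult: "x \<in> braids \<Longrightarrow> y \<in> braids \<Longrightarrow> x * y \<in> braids"

text \<open>Dehornoy's notion: \<open>sigma 0\<close> occurs at least once and its inverse never,
  while the other braid generators occur with any sign.\<close>

inductive_set sigma_positive :: "bullet set" where
  sigma: "sigma 0 \<in> sigma_positive"
| mult: "x \<in> sigma_positive \<Longrightarrow> y \<in> sigma_positive \<Longrightarrow> x * y \<in> sigma_positive"
| left: "x \<in> braids \<Longrightarrow> y \<in> sigma_positive \<Longrightarrow> shift x * y \<in> sigma_positive"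
| right: "x \<in> sigma_positive \<Longrightarrow> y \<in> braids \<Longrightarrow> x * shift y \<in> sigma_positive"

text \<open>Shifted braids fix the first free generator. As \<open>artin\<close> is not closed under
  inversion, \<open>x\<close> and its inverse are treated together, and the inverse case merely
  swaps the two halves.\<close>

lemma artin_shift_braid_aux:
  "x \<in> braids \<Longrightarrow> (\<exists>f. artin (shift x) f \<and> red (f (0, False)) = [(0, False)]) \<and>
     (\<exists>f. artin (shift (inverse x)) f \<and> red (f (0, False)) = [(0, False)])"
proof (induction rule: braids.induct)
  case one
  then show ?case using artin_one by (auto simp: shift_one)
next
  case (sigma i)
  show ?case
    using artin_sigma[of "Suc i"] artin_inverse_sigma[of "Suc i"]
    by (intro conjI exI) (auto simp: shift_inverse shift_sigma artin_subst_def flip_def)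
next
  case (inverse x)
  then show ?case by simp
next
  case (mult x y)
  have *: "\<exists>f. artin (x * y) f \<and> red (f (0, False)) = [(0, False)]"
    if "artin x f \<and> red (f (0, False)) = [(0, False)]" "artin y g \<and> red (g (0, False)) = [(0, False)]" for x y f g
    using that artin_mult[of x f y g] red_subst_red[of f "g (0, False)"]
    by (intro exI[of _ "\<lambda>c. subst f (g c)"]) (auto simp: artin_def)
  show ?case
    using mult * unfolding shift_mult bullet.inverse_distrib_swap by blast
qed

lemma artin_shift_braid: "x \<in> braids \<Longrightarrow> \<exists>f. artin (shift x) f \<and> red (f (0, False)) = [(0, False)]"
  using artin_shift_braid_aux by blast

text \<open>For \<open>sigma 0\<close> the image of \<open>(0, False)\<close> is a conjugate
  starting with \<open>(0, True)\<close>. A left factor preserves this by the invariant, and a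
  shifted right factor fixes \<open>(0, False)\<close>.\<close>

lemma artin_sigma_positive: "x \<in> sigma_positive \<Longrightarrow> \<exists>f. artin x f \<and> starts (f (0, False))"
proof (induction rule: sigma_positive.induct)
  case sigma
  show ?case
    using artin_sigma[of 0] by (intro exI conjI) (auto simp: artin_subst_def flip_def starts_def)
next
  case (mult x y)
  then obtain f g where "artin x f" "artin y g" "starts (g (0, False))" by blast
  then have "artin (x * y) (\<lambda>c. subst f (g c))" "starts (subst f (g (0, False)))"
    by (auto intro: artin_mult artin_starts)
  then show ?case by blast
next
  case (left x y)
  then obtain f g where "artin (shift x) f" "artin y g" "starts (g (0, False))"
    using artin_shift_braid by blast
  then have "artin (shift x * y) (\<lambda>c. subst f (g c))" "starts (subst f (g (0, False)))"
    by (auto intro: artin_mult artin_starts)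
  then show ?case by blast
next
  case (right x y)
  then obtain f g where fg: "artin x f" "starts (f (0, False))"
    "artin (shift y) g" "red (g (0, False)) = [(0, False)]"
    using artin_shift_braid by blast
  have "red (subst f (g (0, False))) = red (f (0, False))"
    using fg red_subst_red[of f "g (0, False)"] by (auto simp: artin_def)
  then have "artin (x * shift y) (\<lambda>c. subst f (g c))" "starts (subst f (g (0, False)))"
    using fg by (auto intro: artin_mult simp: starts_def)
  then show ?case by blast
qed

lemma sigma_positive_nontrivial: "x \<in> sigma_positive \<Longrightarrow> (shift ^^ n) x \<noteq> 1"
proof
  assume x: "x \<in> sigma_positive" and eq: "(shift ^^ n) x = 1"
  have "(\<forall>s :: nat \<Rightarrow> free colour. act ((shift ^^ n) x) s = s) \<Longrightarrow>
      \<forall>s :: nat \<Rightarrow> free colour. act x s = s"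
    by (induction n) (auto intro: act_shift_trivial)
  then have act: "act x s = s" for s :: "nat \<Rightarrow> free colour"
    using eq by simp
  obtain f where f: "artin x f" "starts (f (0, False))"
    using artin_sigma_positive x by blast
  \<comment> \<open>The roots are the free generators themselves, so a trivial action forces the
    image of each generator to reduce to that generator.\<close>
  define s :: "nat \<Rightarrow> free colour" where "s = (\<lambda>i. (abs_free [(i, True)], \<lambda>_. 0))"
  have "fst (act x s 0) = word_value (\<lambda>i. fst (s i)) (f (0, True))"
    using f(1) unfolding artin_def by blast
  then have "abs_free (f (0, True)) = abs_free [(0, True)]"
    by (simp add: act s_def word_value_free)
  then have "red (f (0, True)) = red [(0, True)]"
    by (simp only: free.abs_eq_iff)
  then have "red (winv (f (0, True))) = red (winv [(0, True)])"
    by (rule red_winv_cong)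
  moreover have "f (flip (0, True)) = winv (f (0, True))"
    using f(1) unfolding artin_def by blast
  ultimately show False
    using f(2) by (simp add: starts_def flip_def)
qed

section \<open>Products of shifted factors\<close>

text \<open>The Horner form of \<open>shifted_prod\<close>, suited to induction on lists.\<close>

fun bprod :: "bullet list \<Rightarrow> bullet" where
  "bprod [] = 1"
| "bprod (x # xs) = x * shift (bprod xs)"

lemma bprod_append: "bprod (xs @ ys) = bprod xs * (shift ^^ length xs) (bprod ys)"
  by (induction xs) (simp_all add: shift_mult mult.assoc)

lemma shifted_prod_bprod: "shifted_prod n z = bprod (map z [0..<n])"
  by (induction n) (simp_all add: shifted_prod_def bprod_append shift_one)

lemma shifted_prod_extend:
  assumes "\<And>i. i \<ge> p \<Longrightarrow> z i = 1" "p \<le> n"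
  shows "shifted_prod n z = shifted_prod p z"
  using assms(2)
proof (induction n rule: dec_induct)
  case (step n)
  then show ?case using assms(1)[of n] by (simp add: shifted_prod_def funpow_shift_one)
qed simp

definition padded :: "bullet list \<Rightarrow> nat \<Rightarrow> bullet" where
  "padded xs i = (if i < length xs then xs ! i else 1)"

lemma shifted_prod_padded:
  assumes "length xs \<le> n"
  shows "shifted_prod n (padded xs) = bprod xs"
proof -
  have "map (padded xs) [0..<length xs] = xs"
    by (rule nth_equalityI) (simp_all add: padded_def)
  then show ?thesis
    using shifted_prod_extend[of "length xs" "padded xs" n] assms
    by (simp add: padded_def shifted_prod_bprod)
qed

lemma padded_in: "set xs \<subseteq> C \<Longrightarrow> 1 \<in> C \<Longrightarrow> padded xs i \<in> C"
  by (auto simp: padded_def)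

lemma map_upt_eq_imp_eq:
  assumes "map y [0..<n] = map z [0..<n]" "\<And>i. i \<ge> n \<Longrightarrow> y i = z i"
  shows "y = z"
proof
  fix i
  show "y i = z i"
    using assms(1) assms(2)[of i] by (cases "i < n") (auto simp: not_less)
qed

text \<open>A generator of index \<open>i\<close> passes under the first \<open>i\<close> factors,
  losing one shift at each, so only index 0 needs work.\<close>

lemma bprod_mult_generator:
  assumes shift: "\<And>i. shift (g i) = g (Suc i)" and one: "1 \<in> C"
    and step: "\<And>x y zs. x \<in> C \<Longrightarrow> y \<in> C \<Longrightarrow> set zs \<subseteq> C \<Longrightarrow>
      \<exists>zs'. set zs' \<subseteq> C \<and> bprod zs' = bprod (x # y # zs) * g 0"
  shows "set xs \<subseteq> C \<Longrightarrow> \<exists>xs'. set xs' \<subseteq> C \<and> bprod xs' = bprod xs * g i"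
proof (induction i arbitrary: xs)
  case 0
  show ?case
  \<comment> \<open>\<open>step\<close> needs two leading factors; shorter lists are completed by
    1.\<close>
  proof (cases xs rule: remdups_adj.cases)
    case 1
    then show ?thesis using step[of 1 1 "[]"] one by (simp add: shift_one)
  next
    case (2 x)
    then show ?thesis using step[of x 1 "[]"] one 0 by (simp add: shift_one)
  next
    case (3 x y zs)
    then show ?thesis using step[of x y zs] 0 by simp
  qed
next
  case (Suc i)
  obtain x zs where x: "x \<in> C" "set zs \<subseteq> C" "bprod xs = bprod (x # zs)"
    using Suc.prems one by (cases xs) (auto simp: shift_one intro: that[of 1 "[]"])
  obtain zs' where zs': "set zs' \<subseteq> C" "bprod zs' = bprod zs * g i"
    using Suc.IH x(2) by blast
  have "bprod (x # zs') = bprod xs * g (Suc i)"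
    by (simp add: x(3) zs'(2) shift_mult shift mult.assoc)
  then show ?case using x(1) zs'(1) by (intro exI[of _ "x # zs'"]) simp
qed

lemma bprod_mult_sigma:
  assumes "1 \<in> C" and bracket: "\<And>x y. x \<in> C \<Longrightarrow> y \<in> C \<Longrightarrow> bracket x y \<in> C" and "set xs \<subseteq> C"
  shows "\<exists>xs'. set xs' \<subseteq> C \<and> bprod xs' = bprod xs * sigma i"
proof (rule bprod_mult_generator[where g = sigma, OF shift_sigma assms(1) _ assms(3)])
  fix x y zs assume "x \<in> C" "y \<in> C" "set zs \<subseteq> C"
  then have "set (bracket x y # x # zs) \<subseteq> C"
    by (simp add: bracket)
  moreover have "bprod (bracket x y # x # zs) = bprod (x # y # zs) * sigma 0"
    by (simp add: bracket_def shift_mult shift_shift_sigma mult.assoc)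
  ultimately show "\<exists>zs'. set zs' \<subseteq> C \<and> bprod zs' = bprod (x # y # zs) * sigma 0"
    by blast
qed

lemma bprod_mult_alpha:
  assumes "1 \<in> C" and circ: "\<And>x y. x \<in> C \<Longrightarrow> y \<in> C \<Longrightarrow> circ x y \<in> C" and "set xs \<subseteq> C"
  shows "\<exists>xs'. set xs' \<subseteq> C \<and> bprod xs' = bprod xs * alpha i"
proof (rule bprod_mult_generator[where g = alpha, OF shift_alpha assms(1) _ assms(3)])
  fix x y zs assume "x \<in> C" "y \<in> C" "set zs \<subseteq> C"
  then have "set (circ x y # zs) \<subseteq> C"
    by (simp add: circ)
  moreover have "bprod (circ x y # zs) = bprod (x # y # zs) * alpha 0"
    by (simp add: circ_def shift_mult shift_shift_alpha mult.assoc)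
  ultimately show "\<exists>zs'. set zs' \<subseteq> C \<and> bprod zs' = bprod (x # y # zs) * alpha 0"
    by blast
qed

section \<open>Factoring positive elements into a braid and a Thompson part\<close>

inductive_set submonoid :: "bullet set \<Rightarrow> bullet set" for G where
  one: "1 \<in> submonoid G"
| gen: "x \<in> G \<Longrightarrow> x \<in> submonoid G"
| mult: "x \<in> submonoid G \<Longrightarrow> y \<in> submonoid G \<Longrightarrow> x * y \<in> submonoid G"

lemma bprod_mult_submonoid:
  assumes "\<And>xs g. set xs \<subseteq> C \<Longrightarrow> g \<in> G \<Longrightarrow> \<exists>xs'. set xs' \<subseteq> C \<and> bprod xs' = bprod xs * g"
  shows "x \<in> submonoid G \<Longrightarrow> set xs \<subseteq> C \<Longrightarrow> \<exists>xs'. set xs' \<subseteq> C \<and> bprod xs' = bprod xs * x"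
proof (induction arbitrary: xs rule: submonoid.induct)
  case (mult x y)
  then show ?case by (metis mult.assoc)
qed (use assms in auto)

lemma bprod_submonoid:
  assumes "\<And>xs g. set xs \<subseteq> C \<Longrightarrow> g \<in> G \<Longrightarrow> \<exists>xs'. set xs' \<subseteq> C \<and> bprod xs' = bprod xs * g"
    and "x \<in> submonoid G"
  shows "\<exists>xs. set xs \<subseteq> C \<and> x = bprod xs"
  using bprod_mult_submonoid[OF assms, of "[]"] by fastforce

lemma positive_submonoid: "x \<in> positive \<Longrightarrow> x \<in> submonoid (range sigma \<union> range alpha)"
  by (induction rule: positive.induct) (auto intro: submonoid.intros)

text \<open>Each relation that moves an \<alpha> past a \<sigma> keeps exactly one \<alpha>, only
  its index changing, so the move iterates along a product.\<close>

lemma alpha_mult_braid: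
  "x \<in> submonoid (range sigma) \<Longrightarrow> \<exists>x' \<in> submonoid (range sigma). \<exists>k. alpha j * x = x' * alpha k"
proof (induction arbitrary: j rule: submonoid.induct)
  case one
  show ?case by (intro bexI[of _ 1] exI[of _ j] submonoid.one) simp
next
  case (gen x)
  then obtain i where x: "x = sigma i" by blast
  have sigma: "sigma k \<in> submonoid (range sigma)" for k
    by (simp add: submonoid.gen)
  consider "j = i" | "j = Suc i" | "j \<ge> i + 2" | "j < i" by linarith
  then show ?case
  proof cases
    case 1
    then show ?thesis using alpha_sigma_same[of i] submonoid.mult[OF sigma sigma] by (metis x mult.assoc)
  next
    case 2
    then show ?thesis using alpha_Suc_sigma[of i] submonoid.mult[OF sigma sigma] by (metis x mult.assoc)
  next
    case 3
    then show ?thesis using alpha_sigma_commute sigma x by metis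
  next
    case 4
    then show ?thesis using sigma_alpha[of j i] sigma x by metis
  qed
next
  case (mult x y)
  then show ?case by (metis mult.assoc submonoid.mult)
qed

lemma thompson_mult_braid:
  assumes "h \<in> submonoid (range alpha)"
  shows "x \<in> submonoid (range sigma) \<Longrightarrow>
    \<exists>x' \<in> submonoid (range sigma). \<exists>h' \<in> submonoid (range alpha). h * x = x' * h'"
  using assms
proof (induction arbitrary: x rule: submonoid.induct)
  case one
  show ?case
    by (intro bexI[of _ x] bexI[of _ 1] one submonoid.one) simp
next
  case (gen h)
  then show ?case using alpha_mult_braid submonoid.gen[of _ "range alpha"] by blast
next
  case (mult g h)
  then obtain x' h' where x': "x' \<in> submonoid (range sigma)" "h' \<in> submonoid (range alpha)" "h * x = x' * h'"
    by blast
  moreover obtain x'' g' where x'': "x'' \<in> submonoid (range sigma)" "g' \<in> submonoid (range alpha)" "g * x' = x'' * g'"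
    using mult.IH(1) x'(1) by blast
  ultimately have "g * h * x = x'' * (g' * h')"
    by (metis mult.assoc)
  then show ?case using x' x'' submonoid.mult by blast
qed

lemma positive_factor:
  "x \<in> positive \<Longrightarrow> \<exists>b \<in> submonoid (range sigma). \<exists>h \<in> submonoid (range alpha). x = b * h"
proof (induction rule: positive.induct)
  case one
  show ?case by (intro bexI[of _ 1] submonoid.one) simp
next
  case (sigma i)
  show ?case by (intro bexI[of _ "sigma i"] bexI[of _ 1] submonoid.intros) simp_all
next
  case (alpha i)
  show ?case by (intro bexI[of _ 1] bexI[of _ "alpha i"] submonoid.intros) simp_all
next
  case (mult x y)
  then obtain b h c k where bh: "b \<in> submonoid (range sigma)" "h \<in> submonoid (range alpha)" "x = b * h"
    "c \<in> submonoid (range sigma)" "k \<in> submonoid (range alpha)" "y = c * k" by blast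
  obtain c' h' where ch: "c' \<in> submonoid (range sigma)" "h' \<in> submonoid (range alpha)" "h * c = c' * h'"
    using thompson_mult_braid bh by blast
  have "x * y = (b * c') * (h' * k)"
    using bh(3,6) ch(3) by (metis mult.assoc)
  then show ?case using bh ch submonoid.mult by blast
qed

section \<open>Comparison and separation of special braids\<close>

lemma shift_braids: "x \<in> braids \<Longrightarrow> shift x \<in> braids"
  by (induction rule: braids.induct)
    (auto simp: shift_one shift_sigma shift_inverse shift_mult intro: braids.intros)

lemma bracket_braids: "x \<in> braids \<Longrightarrow> y \<in> braids \<Longrightarrow> bracket x y \<in> braids"
  by (simp add: bracket_def braids.intros shift_braids)

lemma special_braids_subset: "x \<in> special_braids \<Longrightarrow> x \<in> braids"
  by (induction rule: special_braids.induct) (auto intro: bracket_braids braids.one)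

lemma bprod_braids: "set xs \<subseteq> braids \<Longrightarrow> bprod xs \<in> braids"
  by (induction xs) (auto intro: braids.intros shift_braids)

text \<open>Exhibits the special braids as a left-distributive system with one generator, to which
  \<open>left_division_total\<close> applies.\<close>

lemma special_braids_ld_value: "special_braids = range (ld_value bracket 1)"
proof (intro equalityI subsetI)
  note ld_value = ld_value.simps[OF bracket_bracket, where e = 1]
  fix x assume "x \<in> special_braids"
  then have "\<exists>t. x = ld_value bracket 1 t"
  proof (induction rule: special_braids.induct)
    case one
    show ?case by (intro exI[of _ X]) (simp add: ld_value)
  next
    case (bracket x y)
    then obtain t u where "x = ld_value bracket 1 t" "y = ld_value bracket 1 u" by blast
    then show ?case by (intro exI[of _ "App t u"]) (simp add: ld_value)
  qed
  then show "x \<in> range (ld_value bracket 1)" by blast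
next
  note ld_value = ld_value.simps[OF bracket_bracket, where e = 1]
  fix x assume "x \<in> range (ld_value bracket 1)"
  moreover have "ld_value bracket 1 t \<in> special_braids" for t
    by (induction t) (simp_all add: ld_value special_braids.intros)
  ultimately show "x \<in> special_braids" by blast
qed

lemma left_division_sigma_positive:
  assumes "(\<lambda>x y. \<exists>z\<in>special_braids. y = bracket x z)\<^sup>*\<^sup>* x y" "x \<in> braids"
  shows "y \<in> braids \<and> (x = y \<or> inverse x * y \<in> sigma_positive)"
  using assms(1)
proof (induction rule: rtranclp_induct)
  case base
  show ?case using assms(2) by simp
next
  case (step y y')
  then obtain z where z: "z \<in> braids" "y' = bracket y z"
    using special_braids_subset by blast
  \<comment> \<open>A bracket with left argument \<open>y\<close> is \<open>y * q\<close>, and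
    \<open>q\<close> contains \<open>sigma 0\<close> once, positively.\<close>
  define q where "q = shift z * (sigma 0 * shift (inverse y))"
  have "q \<in> sigma_positive"
    unfolding q_def using z step.IH by (intro sigma_positive.intros braids.inverse) auto
  moreover have "inverse x * y' = inverse x * y * q"
    by (simp add: q_def z(2) bracket_def shift_inverse mult.assoc)
  moreover have "y' \<in> braids"
    using z step.IH bracket_braids by blast
  ultimately show ?case
    using step.IH sigma_positive.mult by (metis bullet.left_inverse mult.left_neutral)
qed

lemma special_braids_compare:
  assumes "x \<in> special_braids" "y \<in> special_braids" "x \<noteq> y"
  shows "inverse x * y \<in> sigma_positive \<or> inverse y * x \<in> sigma_positive"
proof -
  obtain t u where "x = ld_value bracket 1 t" "y = ld_value bracket 1 u"
    using assms by (auto simp: special_braids_ld_value)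
  then have "(\<lambda>x y. \<exists>z\<in>special_braids. y = bracket x z)\<^sup>*\<^sup>* x y \<or>
      (\<lambda>x y. \<exists>z\<in>special_braids. y = bracket x z)\<^sup>*\<^sup>* y x"
    using left_division_total[OF bracket_bracket, of 1 t u] by (simp only: special_braids_ld_value)
  then show ?thesis
    using left_division_sigma_positive assms special_braids_subset by blast
qed

text \<open>Equality would make some shift of \<open>inverse x * y * shift (v * inverse u)\<close>
  trivial, although that element is still \<sigma>-positive.\<close>

lemma sigma_positive_separates:
  assumes "inverse x * y \<in> sigma_positive" "u \<in> braids" "v \<in> braids"
  shows "(shift ^^ n) (x * shift u) \<noteq> (shift ^^ n) (y * shift v)"
proof
  assume eq: "(shift ^^ n) (x * shift u) = (shift ^^ n) (y * shift v)"
  have "(shift ^^ n) (inverse x * y * shift (v * inverse u)) =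
      (shift ^^ n) (inverse x) * (shift ^^ n) (y * shift v) * (shift ^^ n) (shift (inverse u))"
    by (simp add: funpow_shift_mult shift_mult mult.assoc)
  also have "\<dots> = (shift ^^ n) (inverse x * (x * shift u) * shift (inverse u))"
    unfolding eq[symmetric] by (simp only: funpow_shift_mult)
  also have "\<dots> = 1"
    by (simp add: shift_inverse funpow_shift_one)
  finally have "(shift ^^ n) (inverse x * y * shift (v * inverse u)) = 1" .
  moreover have "inverse x * y * shift (v * inverse u) \<in> sigma_positive"
    by (intro sigma_positive.right assms braids.intros)
  ultimately show False using sigma_positive_nontrivial by blast
qed

text \<open>The exponent \<open>n\<close> is general because cancelling equal first factors leaves
  the tails under one more shift.\<close>

lemma bprod_special_braids_inject:
  assumes "length xs = length ys" "set xs \<subseteq> special_braids" "set ys \<subseteq> special_braids"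
    "(shift ^^ n) (bprod xs) = (shift ^^ n) (bprod ys)"
  shows "xs = ys"
  using assms
proof (induction xs ys arbitrary: n rule: list_induct2)
  case (Cons x xs y ys)
  have braids: "bprod xs \<in> braids" "bprod ys \<in> braids"
    using Cons.prems special_braids_subset by (auto intro!: bprod_braids)
  have "x = y"
  proof (rule ccontr)
    assume "x \<noteq> y"
    then have "inverse x * y \<in> sigma_positive \<or> inverse y * x \<in> sigma_positive"
      using Cons.prems special_braids_compare by simp
    then show False
      using sigma_positive_separates braids Cons.prems(3) by (metis bprod.simps(2))
  qed
  with Cons.prems(3) have "(shift ^^ n) (shift (bprod xs)) = (shift ^^ n) (shift (bprod ys))"
    by (simp add: funpow_shift_mult bullet.left_cancel)
  then have "(shift ^^ Suc n) (bprod xs) = (shift ^^ Suc n) (bprod ys)"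
    by (simp only: funpow_Suc_right comp_apply)
  then have "xs = ys"
    using Cons.prems by (intro Cons.IH[of "Suc n"]) simp_all
  then show ?case using \<open>x = y\<close> by simp
qed simp

section \<open>Trees of special braids\<close>

datatype 'a tree = Leaf 'a | Node "'a tree" "'a tree"

fun leaves :: "'a tree \<Rightarrow> 'a list" where
  "leaves (Leaf x) = [x]"
| "leaves (Node t u) = leaves t @ leaves u"

fun tree_value :: "bullet tree \<Rightarrow> bullet" where
  "tree_value (Leaf x) = x"
| "tree_value (Node t u) = circ (tree_value t) (tree_value u)"

text \<open>With all leaves 1, the value of the tree is its Thompson part.\<close>

abbreviation skeleton :: "'a tree \<Rightarrow> bullet tree" where
  "skeleton t \<equiv> map_tree (\<lambda>_. 1) t"

lemma set_leaves: "set (leaves t) = set_tree t"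
  by (induction t) auto

lemma length_leaves_skeleton: "length (leaves (skeleton t)) = length (leaves t)"
  by (induction t) auto

lemma tree_eqI: "skeleton t = skeleton u \<Longrightarrow> leaves t = leaves u \<Longrightarrow> t = u"
proof (induction t arbitrary: u)
  case (Leaf x)
  then show ?case by (cases u) auto
next
  case (Node t1 t2)
  obtain u1 u2 where u: "u = Node u1 u2" using Node.prems by (cases u) auto
  have "length (leaves t1) = length (leaves u1)"
    using Node.prems by (metis length_leaves_skeleton tree.inject(2) tree.map(2) u)
  then show ?case using Node u by auto
qed

text \<open>Skeletons fix the number of leaves of each tree, hence how the concatenated list is to
  be cut.\<close>

lemma forest_eqI:
  assumes "length ts = length us" "map skeleton ts = map skeleton us"
    "concat (map leaves ts) = concat (map leaves us)"
  shows "ts = us"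
  using assms
proof (induction ts us rule: list_induct2)
  case (Cons t ts u us)
  have "length (leaves t) = length (leaves u)"
    using Cons.prems by (metis length_leaves_skeleton list.inject list.map(2))
  then show ?case using Cons tree_eqI by auto
qed simp

text \<open>The skeleton glues as many strands as it has leaves into one; what lies beyond that one
  strand lies beyond all of them before gluing.\<close>

lemma skeleton_shift:
  "tree_value (skeleton t) * shift y = (shift ^^ length (leaves t)) y * tree_value (skeleton t)"
proof (induction t arbitrary: y)
  case (Node t u)
  have "tree_value (skeleton (Node t u)) * shift y =
      tree_value (skeleton t) * shift (tree_value (skeleton u) * shift y) * alpha 0"
    by (simp add: circ_def shift_mult shift_shift_alpha mult.assoc)
  also have "\<dots> = (shift ^^ length (leaves (Node t u))) y * tree_value (skeleton (Node t u))"
    by (simp add: Node shift_mult circ_def funpow_add flip: mult.assoc)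
      (simp add: Node mult.assoc)
  finally show ?case .
qed simp

lemma tree_value_factor: "tree_value t = bprod (leaves t) * tree_value (skeleton t)"
proof (induction t)
  case (Node t u)
  have "tree_value (Node t u) =
      bprod (leaves t) * (tree_value (skeleton t) * shift (bprod (leaves u))) *
      shift (tree_value (skeleton u)) * alpha 0"
    using Node by (simp add: circ_def shift_mult mult.assoc)
  also have "\<dots> = bprod (leaves (Node t u)) * tree_value (skeleton (Node t u))"
    by (simp add: skeleton_shift bprod_append circ_def mult.assoc)
  finally show ?case .
qed (simp add: shift_one)

text \<open>Moving all leaves left of all skeletons reduces the first decomposition to the
  braid-Thompson form.\<close>

lemma forest_value_factor:
  "bprod (map tree_value ts) =
    bprod (concat (map leaves ts)) * bprod (map (\<lambda>t. tree_value (skeleton t)) ts)"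
proof (induction ts)
  case (Cons t ts)
  have "bprod (map tree_value (t # ts)) =
      bprod (leaves t) * (tree_value (skeleton t) * shift (bprod (concat (map leaves ts)))) *
      shift (bprod (map (\<lambda>t. tree_value (skeleton t)) ts))"
    by (simp add: Cons tree_value_factor[of t] shift_mult mult.assoc)
  then show ?case
    by (simp add: skeleton_shift bprod_append mult.assoc)
qed simp

section \<open>Reading skeletons off from integer colours\<close>

abbreviation unit_colour :: "int colour" where
  "unit_colour \<equiv> (1, \<lambda>_. 0)"

fun tree_colour :: "'a tree \<Rightarrow> int colour" where
  "tree_colour (Leaf x) = unit_colour"
| "tree_colour (Node t u) = node_colour (tree_colour t) (tree_colour u)"

lemma tree_colour_pos: "fst (tree_colour t) > 0"
  by (induction t) auto

text \<open>At the position \<open>[]\<close> a leaf has value 0, while a node has the positive root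
  value of its left subtree; nodes then split by \<open>left_colour\<close> and
  \<open>right_colour\<close>.\<close>

lemma tree_colour_inject: "tree_colour t = tree_colour u \<Longrightarrow> skeleton t = skeleton u"
proof (induction t arbitrary: u)
  case (Leaf x)
  then show ?case
  proof (cases u)
    case (Node u1 u2)
    then show ?thesis
      using Leaf tree_colour_pos[of u1] by (auto simp: node_colour_def dest: fun_cong[where x = "[]"])
  qed simp
next
  case (Node t1 t2)
  then show ?case
  proof (cases u)
    case (Leaf x)
    then show ?thesis
      using Node.prems tree_colour_pos[of t1] by (auto simp: node_colour_def dest: fun_cong[where x = "[]"])
  next
    case (Node u1 u2)
    then show ?thesis
      using Node.prems Node.IH by (metis left_right_colour(1,2) tree.map(2) tree_colour.simps(2))
  qed
qed

lemma act_skeleton: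
  "act (tree_value (skeleton t)) (\<lambda>_. unit_colour) = case_nat (tree_colour t) (\<lambda>_. unit_colour)"
proof (induction t)
  case (Node t u)
  then show ?case
    by (auto simp: circ_def act_shift act_alpha fun_eq_iff split: nat.split)
qed (auto simp: fun_eq_iff split: nat.split)

lemma act_forest:
  "act (bprod (map (\<lambda>t. tree_value (skeleton t)) ts)) (\<lambda>_. unit_colour) =
    (\<lambda>i. if i < length ts then tree_colour (ts ! i) else unit_colour)"
proof (induction ts)
  case (Cons t ts)
  then show ?case
    by (auto simp: act_shift act_skeleton fun_eq_iff split: nat.split)
qed simp

text \<open>Conjugation is trivial in the integers, so braids only permute the entries of a constant
  sequence.\<close>

lemma act_braid: "x \<in> braids \<Longrightarrow> act x (\<lambda>_. unit_colour) = (\<lambda>_. unit_colour)"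
proof (induction rule: braids.induct)
  case (inverse x)
  then show ?case using act_inverse[of x "\<lambda>_. unit_colour"] by simp
qed (auto simp: act_sigma conj_colour_def)

lemma braid_forest_inject:
  assumes "length ts = length us"
    and xs: "set xs \<subseteq> special_braids" and ys: "set ys \<subseteq> special_braids"
    and eq: "bprod xs * bprod (map (\<lambda>t. tree_value (skeleton t)) ts) =
      bprod ys * bprod (map (\<lambda>t. tree_value (skeleton t)) us)"
  shows "map skeleton ts = map skeleton us \<and> bprod xs = bprod ys"
proof -
  have "bprod xs \<in> braids" "bprod ys \<in> braids"
    using xs ys special_braids_subset by (auto intro!: bprod_braids)
  with arg_cong[OF eq, of "\<lambda>x. act x (\<lambda>_. unit_colour)"]
  have "(\<lambda>i. if i < length ts then tree_colour (ts ! i) else unit_colour) =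
      (\<lambda>i. if i < length us then tree_colour (us ! i) else unit_colour)"
    by (simp add: act_braid act_forest)
  then have "tree_colour (ts ! i) = tree_colour (us ! i)" if "i < length ts" for i
    using that assms(1) by (auto dest: fun_cong[where x = i])
  then have skel: "map skeleton ts = map skeleton us"
    using assms(1) by (auto intro!: nth_equalityI tree_colour_inject)
  have "map (\<lambda>t. tree_value (skeleton t)) ts = map (\<lambda>t. tree_value (skeleton t)) us"
    using arg_cong[OF skel, of "map tree_value"] by (simp add: comp_def)
  with eq skel show ?thesis
    by (metis bullet.right_cancel)
qed

section \<open>Special elements as trees\<close>

lemma bracket_tree_value:
  assumes "set_tree t \<subseteq> special_braids" "set_tree u \<subseteq> special_braids"
  shows "\<exists>v. set_tree v \<subseteq> special_braids \<and> bracket (tree_value t) (tree_value u) = tree_value v"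
  using assms
proof (induction t arbitrary: u)
  case (Leaf x)
  from Leaf.prems(2) show ?case
  proof (induction u)
    case (Leaf y)
    with Leaf.prems \<open>set_tree (Leaf x) \<subseteq> special_braids\<close> show ?case
      by (intro exI[of _ "Leaf (bracket x y)"]) (auto intro: special_braids.bracket)
  next
    case (Node u1 u2)
    then obtain v1 v2 where "set_tree v1 \<subseteq> special_braids" "bracket x (tree_value u1) = tree_value v1"
      "set_tree v2 \<subseteq> special_braids" "bracket x (tree_value u2) = tree_value v2"
      by auto
    then show ?case
      by (intro exI[of _ "Node v1 v2"]) (simp add: bracket_circ_right)
  qed
next
  case (Node t1 t2)
  then obtain v where "set_tree v \<subseteq> special_braids" "bracket (tree_value t2) (tree_value u) = tree_value v"
    by (metis Un_subset_iff tree.set(2))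
  \<comment> \<open>By \<open>bracket_circ_left\<close> the brackets nest, so the hypothesis for
    \<open>t1\<close> is applied to the tree \<open>v\<close> just built; this is why
    \<open>u\<close> is arbitrary.\<close>
  moreover then obtain w where "set_tree w \<subseteq> special_braids" "bracket (tree_value t1) (tree_value v) = tree_value w"
    using Node.IH(1)[of v] Node.prems by auto
  ultimately show ?case by (auto simp: bracket_circ_left)
qed

lemma special_parenthesized_braid_tree:
  "z \<in> special_parenthesized_braids \<Longrightarrow> \<exists>t. set_tree t \<subseteq> special_braids \<and> z = tree_value t"
proof (induction rule: special_parenthesized_braids.induct)
  case one
  show ?case by (intro exI[of _ "Leaf 1"]) (simp add: special_braids.one)
next
  case (bracket x y)
  then show ?case using bracket_tree_value by metis
next
  case (circ x y)
  then obtain t u where "set_tree t \<subseteq> special_braids" "x = tree_value t"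
    "set_tree u \<subseteq> special_braids" "y = tree_value u" by blast
  then show ?case by (intro exI[of _ "Node t u"]) simp
qed

lemma special_thompson_tree: "h \<in> special_thompson \<Longrightarrow> \<exists>t :: bullet tree. h = tree_value (skeleton t)"
proof (induction rule: special_thompson.induct)
  case one
  show ?case by (intro exI[of _ "Leaf 1"]) simp
next
  case (circ x y)
  then obtain t u :: "bullet tree" where "x = tree_value (skeleton t)" "y = tree_value (skeleton u)" by blast
  then show ?case by (intro exI[of _ "Node t u"]) simp
qed

lemma list_choice:
  assumes "\<And>z. z \<in> C \<Longrightarrow> \<exists>t. P t \<and> z = f t"
  shows "set zs \<subseteq> C \<Longrightarrow> \<exists>ts. (\<forall>t \<in> set ts. P t) \<and> zs = map f ts"
proof (induction zs)
  case (Cons z zs)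
  then obtain t ts where "P t" "z = f t" "\<forall>t \<in> set ts. P t" "zs = map f ts"
    using assms by (metis insert_subset list.set(2))
  then show ?case by (intro exI[of _ "t # ts"]) simp
qed simp

lemma bprod_special_inject:
  assumes "length xs = length ys" "set xs \<subseteq> special_parenthesized_braids"
    "set ys \<subseteq> special_parenthesized_braids" "bprod xs = bprod ys"
  shows "xs = ys"
proof -
  obtain ts where ts: "\<forall>t \<in> set ts. set_tree t \<subseteq> special_braids" "xs = map tree_value ts"
    using list_choice[OF special_parenthesized_braid_tree assms(2)] by blast
  obtain us where us: "\<forall>t \<in> set us. set_tree t \<subseteq> special_braids" "ys = map tree_value us"
    using list_choice[OF special_parenthesized_braid_tree assms(3)] by blast
  let ?leaves = "\<lambda>ts. concat (map leaves ts)"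
  have len: "length ts = length us"
    using assms(1) ts us by simp
  have sub: "set (?leaves ts) \<subseteq> special_braids" "set (?leaves us) \<subseteq> special_braids"
    using ts us by (auto simp: set_leaves)
  have "bprod (?leaves ts) * bprod (map (\<lambda>t. tree_value (skeleton t)) ts) =
      bprod (?leaves us) * bprod (map (\<lambda>t. tree_value (skeleton t)) us)"
    using assms(4) ts(2) us(2) by (simp add: forest_value_factor)
  then have skel: "map skeleton ts = map skeleton us" and eq: "bprod (?leaves ts) = bprod (?leaves us)"
    using braid_forest_inject[OF len sub] by blast+
  \<comment> \<open>Equal skeletons have equally many leaves, which supplies the equal lengths for
    cancelling the braid parts.\<close>
  have "length (?leaves ts) = length (?leaves us)"
    using arg_cong[OF skel, of "map (length \<circ> leaves)"]
    by (simp add: length_concat comp_def length_leaves_skeleton)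
  then have "?leaves ts = ?leaves us"
    using bprod_special_braids_inject[of _ _ 0] sub eq by simp
  then show ?thesis
    using forest_eqI[OF len skel] ts us by simp
qed


section \<open>Existence and uniqueness of the two decompositions\<close>

lemma special_decomposition_exists:
  assumes "x \<in> positive"
  shows "\<exists>z. is_special_decomposition x z"
proof -
  let ?C = special_parenthesized_braids
  have "\<exists>xs'. set xs' \<subseteq> ?C \<and> bprod xs' = bprod xs * g"
    if "set xs \<subseteq> ?C" "g \<in> range sigma \<union> range alpha" for xs g
    using that bprod_mult_sigma[of ?C xs] bprod_mult_alpha[of ?C xs]
    by (auto simp: special_parenthesized_braids.intros)
  then obtain xs where "set xs \<subseteq> ?C" "x = bprod xs"
    using bprod_submonoid positive_submonoid assms by metis
  then have "is_special_decomposition x (padded xs)"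
    unfolding is_special_decomposition_def
    by (auto intro!: exI[of _ "length xs"] padded_in special_parenthesized_braids.one
        simp: shifted_prod_padded) (simp add: padded_def)
  then show ?thesis by blast
qed

lemma special_decomposition_unique:
  assumes "is_special_decomposition x y" "is_special_decomposition x z"
  shows "y = z"
proof -
  obtain p q where pq: "\<And>i. i \<ge> p \<Longrightarrow> y i = 1" "x = shifted_prod p y"
    "\<And>i. i \<ge> q \<Longrightarrow> z i = 1" "x = shifted_prod q z"
    using assms unfolding is_special_decomposition_def by blast
  \<comment> \<open>A common length, beyond which both sequences are 1.\<close>
  define n where "n = max p q"
  have "x = shifted_prod n y" "x = shifted_prod n z"
    using pq shifted_prod_extend[of p y n] shifted_prod_extend[of q z n] by (simp_all add: n_def)
  then have "map y [0..<n] = map z [0..<n]"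
    using assms by (intro bprod_special_inject) (auto simp: is_special_decomposition_def shifted_prod_bprod)
  then show ?thesis
    by (rule map_upt_eq_imp_eq) (simp add: pq n_def)
qed

lemma braid_thompson_decomposition_exists:
  assumes "x \<in> positive"
  shows "\<exists>\<beta> h. is_braid_thompson_decomposition x \<beta> h"
proof -
  obtain b h where bh: "b \<in> submonoid (range sigma)" "h \<in> submonoid (range alpha)" "x = b * h"
    using positive_factor assms by blast
  have "\<exists>xs'. set xs' \<subseteq> special_braids \<and> bprod xs' = bprod xs * g"
    if "set xs \<subseteq> special_braids" "g \<in> range sigma" for xs g
    using that bprod_mult_sigma[of special_braids xs] by (auto simp: special_braids.intros)
  then obtain xs where xs: "set xs \<subseteq> special_braids" "b = bprod xs"
    using bprod_submonoid bh(1) by metis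
  have "\<exists>xs'. set xs' \<subseteq> special_thompson \<and> bprod xs' = bprod xs * g"
    if "set xs \<subseteq> special_thompson" "g \<in> range alpha" for xs g
    using that bprod_mult_alpha[of special_thompson xs] by (auto simp: special_thompson.intros)
  then obtain ys where ys: "set ys \<subseteq> special_thompson" "h = bprod ys"
    using bprod_submonoid bh(2) by metis
  define n where "n = max (length xs) (length ys)"
  have "\<forall>i\<ge>n. padded xs i = 1 \<and> padded ys i = 1"
    by (simp add: n_def padded_def)
  moreover have "x = shifted_prod n (padded xs) * shifted_prod n (padded ys)"
    by (simp add: shifted_prod_padded n_def bh(3) xs(2) ys(2))
  ultimately have "is_braid_thompson_decomposition x (padded xs) (padded ys)"
    unfolding is_braid_thompson_decomposition_def
    using padded_in[OF xs(1) special_braids.one] padded_in[OF ys(1) special_thompson.one] by blast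
  then show ?thesis by blast
qed

lemma braid_thompson_decomposition_unique:
  assumes "is_braid_thompson_decomposition x \<beta> h" "is_braid_thompson_decomposition x \<gamma> k"
  shows "\<beta> = \<gamma> \<and> h = k"
proof -
  obtain p q where p: "\<And>i. i \<ge> p \<Longrightarrow> \<beta> i = 1" "\<And>i. i \<ge> p \<Longrightarrow> h i = 1"
      "x = shifted_prod p \<beta> * shifted_prod p h"
    and q: "\<And>i. i \<ge> q \<Longrightarrow> \<gamma> i = 1" "\<And>i. i \<ge> q \<Longrightarrow> k i = 1"
      "x = shifted_prod q \<gamma> * shifted_prod q k"
    using assms unfolding is_braid_thompson_decomposition_def by blast
  define n where "n = max p q"
  define bs where "bs z = map z [0..<n]" for z :: "nat \<Rightarrow> bullet"
  have set: "set (bs \<beta>) \<subseteq> special_braids" "set (bs \<gamma>) \<subseteq> special_braids"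
    "set (bs h) \<subseteq> special_thompson" "set (bs k) \<subseteq> special_thompson"
    using assms by (auto simp: is_braid_thompson_decomposition_def bs_def)
  have "shifted_prod n \<beta> = shifted_prod p \<beta>" "shifted_prod n h = shifted_prod p h"
    "shifted_prod n \<gamma> = shifted_prod q \<gamma>" "shifted_prod n k = shifted_prod q k"
    by (rule shifted_prod_extend; simp add: n_def p(1,2) q(1,2))+
  then have "shifted_prod n \<beta> * shifted_prod n h = shifted_prod n \<gamma> * shifted_prod n k"
    using p(3) q(3) by metis
  then have eq: "bprod (bs \<beta>) * bprod (bs h) = bprod (bs \<gamma>) * bprod (bs k)"
    by (simp add: bs_def shifted_prod_bprod)
  \<comment> \<open>The conjunct \<open>True\<close> is the side condition in the form that
    \<open>list_choice\<close> expects.\<close>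
  have tree: "\<exists>t :: bullet tree. True \<and> h = tree_value (skeleton t)" if "h \<in> special_thompson" for h
    using special_thompson_tree[OF that] by simp
  obtain ts :: "bullet tree list" where ts: "bs h = map (\<lambda>t. tree_value (skeleton t)) ts"
    using list_choice[OF tree set(3)] by blast
  obtain us :: "bullet tree list" where us: "bs k = map (\<lambda>t. tree_value (skeleton t)) us"
    using list_choice[OF tree set(4)] by blast
  have len: "length ts = length us"
    using arg_cong[OF ts, of length] arg_cong[OF us, of length] by (simp add: bs_def)
  have skel: "map skeleton ts = map skeleton us" and "bprod (bs \<beta>) = bprod (bs \<gamma>)"
    using braid_forest_inject[OF len set(1,2)] eq unfolding ts us by blast+
  then have "bs \<beta> = bs \<gamma>"
    using bprod_special_braids_inject[of "bs \<beta>" "bs \<gamma>" 0] set by (simp add: bs_def)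
  moreover have "bs h = bs k"
    using arg_cong[OF skel, of "map tree_value"] by (simp add: ts us comp_def)
  ultimately show ?thesis
    using map_upt_eq_imp_eq[of \<beta> n \<gamma>] map_upt_eq_imp_eq[of h n k] p(1,2) q(1,2)
    by (simp add: bs_def n_def)
qed

theorem proposition3p21:
  fixes x :: bullet
  assumes "x \<in> positive"
  shows "(\<exists>!z. is_special_decomposition x z) \<and>
         (\<exists>!(\<beta>, h). is_braid_thompson_decomposition x \<beta> h)"
proof
  show "\<exists>!z. is_special_decomposition x z"
    using special_decomposition_exists[OF assms] special_decomposition_unique by blast
  obtain \<beta> h where "is_braid_thompson_decomposition x \<beta> h"
    using braid_thompson_decomposition_exists[OF assms] by blast
  then show "\<exists>!(\<beta>, h). is_braid_thompson_decomposition x \<beta> h"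
    by (intro ex1I[of _ "(\<beta>, h)"]) (auto dest: braid_thompson_decomposition_unique)
qed

end
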